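(* Assume: (a) in every compact Hausdorff countably tight space, every locally countable subspace of cardinality $\aleph_1$ is $\sigma$-discrete; and (b) every normal first countable space is collectionwise Hausdorff. Then every locally compact, perfectly normal space is paracompact.
   Context: A space is collectionwise Hausdorff if every closed discrete subset $D$ can be separated by a pairwise disjoint family of open sets $\{U_d : d\in D\}$ with $d\in U_d$. A subspace is $\sigma$-discrete if it is a countable union of discrete subspaces. A space is countably tight if whenever $x\in\overline{A}$ there is a countable $B\subseteq A$ with $x\in\overline{B}$. *)

theory Defs
  imports "HOL-Analysis.Analysis"
begin

text \<open>
  Topological spaces are the abstract topologies of the library, so \<open>normal_space\<close> does not
  include any point separation. The usual conventions that all spaces are Hausdorff and that
  normality includes the Hausdorff property are made explicit by separate \<open>Hausdorff_space\<close>
  hypotheses.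
\<close>

definition discrete_subspace :: "'a topology \<Rightarrow> 'a set \<Rightarrow> bool"
  where "discrete_subspace X D \<longleftrightarrow> subtopology X D = discrete_topology D"

definition collectionwise_Hausdorff :: "'a topology \<Rightarrow> bool"
  where "collectionwise_Hausdorff X \<longleftrightarrow>
    (\<forall>D. closedin X D \<and> discrete_subspace X D \<longrightarrow>
      (\<exists>U. (\<forall>d\<in>D. openin X (U d) \<and> d \<in> U d) \<and> disjoint_family_on U D))"

definition sigma_discrete_subspace :: "'a topology \<Rightarrow> 'a set \<Rightarrow> bool"
  where "sigma_discrete_subspace X Y \<longleftrightarrow>
    (\<exists>F :: nat \<Rightarrow> 'a set. (\<forall>n. discrete_subspace X (F n)) \<and> Y = (\<Union>n. F n))"

definition countably_tight :: "'a topology \<Rightarrow> bool"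
  where "countably_tight X \<longleftrightarrow>
    (\<forall>A x. A \<subseteq> topspace X \<and> x \<in> X closure_of A \<longrightarrow>
      (\<exists>B. B \<subseteq> A \<and> countable B \<and> x \<in> X closure_of B))"

definition locally_countable_space :: "'a topology \<Rightarrow> bool"
  where "locally_countable_space X \<longleftrightarrow>
    (\<forall>x\<in>topspace X. \<exists>U. openin X U \<and> x \<in> U \<and> countable U)"

definition has_card_aleph1 :: "'a set \<Rightarrow> bool"
  where "has_card_aleph1 A \<longleftrightarrow>
    (BNF_Cardinal_Order_Relation.card_of A, cardSuc natLeq) \<in> ordIso"

definition perfectly_normal_space :: "'a topology \<Rightarrow> bool"
  where "perfectly_normal_space X \<longleftrightarrow>
    normal_space X \<and> (\<forall>C. closedin X C \<longrightarrow> gdelta_in X C)"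

definition paracompact_space :: "'a topology \<Rightarrow> bool"
  where "paracompact_space X \<longleftrightarrow>
    (\<forall>\<U>. (\<forall>U\<in>\<U>. openin X U) \<and> \<Union>\<U> = topspace X \<longrightarrow>
      (\<exists>\<V>. (\<forall>V\<in>\<V>. openin X V) \<and> \<Union>\<V> = topspace X \<and>
           (\<forall>V\<in>\<V>. \<exists>U\<in>\<U>. V \<subseteq> U) \<and> locally_finite_in X \<V>))"

text \<open>
  HOL cannot quantify over types inside a proposition, so "every space" in a hypothesis means
  every topology on a (not necessarily full) carrier in a fixed type \<open>'a\<close>, that is, up to
  homeomorphism, every space of cardinality at most that of \<open>'a\<close>. The type \<open>'a\<close> is itself
  arbitrary.
\<close>

end

theory Submission
  imports Defs
begin

text \<open>
  A locally compact perfectly normal space $X$ is first countable, hence collectionwise Hausdorff,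
  and discrete subspaces of $X$ are countable unions of closed discrete sets. Together with
  normality, every closed discrete set expands to a discrete family of open sets.
  Compact sets are hereditarily Lindelof, because open sets are $F_\sigma$; using this, transfinite
  recursions of length $\omega_1$ produce an open cover by relatively compact sets each of which
  meets at most $\aleph_1$ others. Its chain components are clopen and have the form
  $\bigcup_{i<\omega_1} U_i$.

  In such a piece let $W_l = \bigcup_{i<l} U_i$ and pick
  $x_l \in \overline{W_l} \setminus W_l$ whenever $W_l$ is not closed. The points $x_l$ form a locally
  countable set of size at most $\aleph_1$, which by the first hypothesis, applied in the one-point
  compactification, is a countable union of closed discrete sets. Their discrete open expansions
  show that $W_l$ is clopen for a closed unbounded set of $l$. Cutting the $U_i$ along these $l$
  gives a star-countable open cover, so $X$ is a topological sum of Lindelof spaces.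
\<close>

section \<open>The first uncountable ordinal\<close>

unbundle cardinal_syntax

text \<open>Two limits of the hypotheses shape the proof. Hypothesis (a) controls only sets of size
  aleph_1, while X may be arbitrarily large, so X is first cut into pieces indexed by omega_1. And
  (a) speaks of compact spaces, so the one-point compactification has to be countably tight; at
  infinity this rests on the fact that a set with noncompact closure has a countable subset with
  noncompact closure. The cut needs an open cover with small stars. Disjointifying a cover by
  relatively compact sets along a well-order yields sets of which each compact set meets only
  countably many, but they are no longer open. Openness is regained by choosing points in them and
  expanding these points, at the price of aleph_1 members per compact set and omega_1 rounds. In the
  last step a closing-off argument takes the place of pressing down: expanding all x_l at once
  leaves, for each i, only countably many l whose open set meets U_i, and W_l is closed for every l
  that is closed under these countable sets.\<close>

typedef omega1 = "Field (cardSuc natLeq)"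
  using Field_cardSuc_not_empty natLeq_Card_order by blast

text \<open>As a type of class \<open>wellorder\<close>, omega_1 comes with \<open>LEAST\<close>,
  initial segments \<open>{..<i}\<close> and the recursion principle
  \<open>dependent_wellorder_choice\<close>.\<close>

instantiation omega1 :: wellorder
begin

definition less_eq_omega1 :: "omega1 \<Rightarrow> omega1 \<Rightarrow> bool"
  where "i \<le> j \<longleftrightarrow> (Rep_omega1 i, Rep_omega1 j) \<in> cardSuc natLeq"

definition less_omega1 :: "omega1 \<Rightarrow> omega1 \<Rightarrow> bool"
  where "i < j \<longleftrightarrow> (Rep_omega1 i, Rep_omega1 j) \<in> cardSuc natLeq - Id"

instance
proof
  have wo: "Well_order (cardSuc natLeq)"
    by (simp add: cardSuc_Well_order natLeq_Card_order)
  then have refl: "refl_on (Field (cardSuc natLeq)) (cardSuc natLeq)"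
    and tr: "trans (cardSuc natLeq)"
    and anti: "antisym (cardSuc natLeq)"
    and tot: "total_on (Field (cardSuc natLeq)) (cardSuc natLeq)"
    and wf: "wf (cardSuc natLeq - Id)"
    by (auto simp: order_on_defs)
  fix i j k :: omega1
  show "i \<le> i"
    using refl by (simp add: less_eq_omega1_def refl_onD Rep_omega1)
  show "i \<le> j \<Longrightarrow> j \<le> i \<Longrightarrow> i = j"
    using anti Rep_omega1_inject by (metis antisymD less_eq_omega1_def)
  then show "i < j \<longleftrightarrow> i \<le> j \<and> \<not> j \<le> i"
    using \<open>i \<le> i\<close> by (auto simp: less_eq_omega1_def less_omega1_def Rep_omega1_inject)
  show "i \<le> j \<Longrightarrow> j \<le> k \<Longrightarrow> i \<le> k"
    using tr by (auto simp: less_eq_omega1_def dest: transD)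
  show "i \<le> j \<or> j \<le> i"
    using tot \<open>i \<le> i\<close> Rep_omega1[of i] Rep_omega1[of j]
    by (cases "i = j") (auto simp: less_eq_omega1_def total_on_def Rep_omega1_inject)
  show "P i" if "\<And>x. (\<And>y. y < x \<Longrightarrow> P y) \<Longrightarrow> P x" for P
    using wf_inv_image[OF wf, of Rep_omega1]
    by (induction i rule: wf_induct_rule) (auto intro: that simp: less_omega1_def)
qed

end

lemma countable_iff_ordLeq_natLeq: "countable A \<longleftrightarrow> |A| \<le>o natLeq"
proof -
  have "countable A \<longleftrightarrow> |A| \<le>o |UNIV :: nat set|"
    unfolding countable_def card_of_ordLeq[symmetric] by auto
  then show ?thesis
    using card_of_nat ordLeq_ordIso_trans ordIso_symmetric by blast
qed

lemma card_of_omega1: "|UNIV :: omega1 set| =o cardSuc natLeq"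
proof -
  have "|UNIV :: omega1 set| =o |Field (cardSuc natLeq)|"
    by (rule card_of_ordIsoI[of Rep_omega1])
      (simp add: bij_betw_def inj_on_def Rep_omega1_inject
        type_definition.Rep_range[OF type_definition_omega1])
  then show ?thesis
    using card_of_Field_ordIso[OF cardSuc_Card_order[OF natLeq_Card_order]] ordIso_transitive by blast
qed

lemma uncountable_omega1: "uncountable (UNIV :: omega1 set)"
proof
  assume "countable (UNIV :: omega1 set)"
  then have "|UNIV :: omega1 set| \<le>o natLeq"
    using countable_iff_ordLeq_natLeq by blast
  then have "cardSuc natLeq \<le>o natLeq"
    using card_of_omega1 ordIso_ordLeq_trans ordIso_symmetric by blast
  then show False
    using cardSuc_greater[OF natLeq_Card_order] not_ordLess_ordLeq by blast
qed

lemma infinite_omega1: "infinite (UNIV :: omega1 set)"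
  using uncountable_omega1 countable_finite by blast

lemma countable_lessThan_omega1: "countable {..<i :: omega1}"
proof -
  let ?S = "underS (cardSuc natLeq) (Rep_omega1 i)"
  have "|?S| <o cardSuc natLeq"
    by (rule card_of_underS[OF cardSuc_Card_order[OF natLeq_Card_order] Rep_omega1])
  then have "|?S| \<le>o natLeq"
    by (rule cardSuc_ordLeq_ordLess[OF natLeq_Card_order card_of_Card_order, THEN iffD1])
  then have "countable ?S"
    by (simp add: countable_iff_ordLeq_natLeq)
  moreover have "Rep_omega1 ` {..<i} \<subseteq> ?S"
    by (auto simp: underS_def less_omega1_def)
  ultimately have "countable (Rep_omega1 ` {..<i})"
    by (rule countable_subset[rotated])
  then show ?thesis
    by (rule countable_image_inj_on) (simp add: inj_on_def Rep_omega1_inject)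
qed

lemma countable_atMost_omega1: "countable {..i :: omega1}"
proof -
  have "{..i} = insert i {..<i}"
    by auto
  then show ?thesis
    by (simp add: countable_lessThan_omega1)
qed

text \<open>Regularity of omega_1: countably many countable initial segments cannot exhaust an
  uncountable order. It supplies the free colour, the stage at which a recursion stops, and the
  bound in the closing-off argument.\<close>

lemma countable_bounded_omega1:
  assumes "countable S"
  obtains i :: omega1 where "S \<subseteq> {..<i}"
proof -
  have "countable (\<Union>s\<in>S. {..s})"
    using assms countable_atMost_omega1 by blast
  then have "(\<Union>s\<in>S. {..s}) \<noteq> UNIV"
    using uncountable_omega1 by metis
  then obtain i where "i \<notin> (\<Union>s\<in>S. {..s})"
    by blast
  then show thesis
    by (intro that[of i]) (auto simp: not_le)
qed

lemma has_card_aleph1I: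
  assumes "uncountable A" "A \<lesssim> (UNIV :: omega1 set)"
  shows "has_card_aleph1 A"
proof -
  have "|A| \<le>o |UNIV :: omega1 set|"
    using assms(2) card_of_ordLeq unfolding lepoll_def by blast
  then have "|A| \<le>o cardSuc natLeq"
    using card_of_omega1 ordLeq_ordIso_trans by blast
  moreover have "cardSuc natLeq \<le>o |A|"
  proof (rule cardSuc_least[OF natLeq_Card_order card_of_Card_order])
    show "natLeq <o |A|"
      using assms(1) countable_iff_ordLeq_natLeq[of A]
        not_ordLeq_iff_ordLess[OF natLeq_Well_order card_of_Well_order[of A]] by simp
  qed
  ultimately show ?thesis
    by (simp add: has_card_aleph1_def ordIso_iff_ordLeq)
qed

section \<open>Cardinal bounds for unions and chains\<close>

lemma lepoll_iff_ordLeq: "A \<lesssim> B \<longleftrightarrow> |A| \<le>o |B|"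
  unfolding lepoll_def by (rule card_of_ordLeq)

lemma UN_lepoll_infinite:
  assumes "infinite K" "A \<lesssim> K" "\<And>a. a \<in> A \<Longrightarrow> B a \<lesssim> K"
  shows "(\<Union>a\<in>A. B a) \<lesssim> K"
  using assms unfolding lepoll_iff_ordLeq by (intro card_of_UNION_ordLeq_infinite) auto

lemma subset_lepoll_trans: "A \<subseteq> B \<Longrightarrow> B \<lesssim> K \<Longrightarrow> A \<lesssim> K"
  by (rule lepoll_trans[OF subset_imp_lepoll])

lemma countable_iff_lepoll_nat: "countable A \<longleftrightarrow> A \<lesssim> (UNIV :: nat set)"
  by (auto simp: countable_def lepoll_def)

lemma countable_imp_lepoll_infinite: "infinite K \<Longrightarrow> countable A \<Longrightarrow> A \<lesssim> K"
  unfolding infinite_le_lepoll countable_iff_lepoll_nat by (rule lepoll_trans)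

text \<open>Serves two purposes: it bounds the chain components of a cover with small stars, and it
  closes an ordinal off under countably many new ordinals at each step.\<close>

lemma rtrancl_Image_lepoll:
  assumes "infinite K" "\<And>x. R `` {x} \<lesssim> K"
  shows "R\<^sup>* `` {x} \<lesssim> K"
proof -
  have "(R ^^ n) `` {x} \<lesssim> K" for n
  proof (induction n)
    case 0
    then show ?case
      using assms(1) by (simp add: countable_imp_lepoll_infinite)
  next
    case (Suc n)
    have "(R ^^ Suc n) `` {x} = (\<Union>y\<in>(R ^^ n) `` {x}. R `` {y})"
      by auto
    then show ?case
      using UN_lepoll_infinite[OF assms(1) Suc assms(2)] by simp
  qed
  then have "(\<Union>n. (R ^^ n) `` {x}) \<lesssim> K"
    using assms(1) infinite_le_lepoll by (intro UN_lepoll_infinite) auto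
  moreover have "R\<^sup>* `` {x} = (\<Union>n. (R ^^ n) `` {x})"
    by (auto simp: rtrancl_is_UN_relpow)
  ultimately show ?thesis
    by simp
qed

section \<open>Discrete sets, chain components and paracompactness\<close>

lemma discrete_subspace_iff:
  "discrete_subspace X D \<longleftrightarrow>
     D \<subseteq> topspace X \<and> (\<forall>d\<in>D. \<exists>U. openin X U \<and> U \<inter> D = {d})"
proof
  assume D: "discrete_subspace X D"
  then have "topspace (subtopology X D) = D" and op: "\<And>S. S \<subseteq> D \<Longrightarrow> openin (subtopology X D) S"
    by (simp_all add: discrete_subspace_def)
  then have "D \<subseteq> topspace X"
    by (metis inf_le1 topspace_subtopology)
  moreover have "\<exists>U. openin X U \<and> U \<inter> D = {d}" if "d \<in> D" for d
    using op[of "{d}"] that by (auto simp: openin_subtopology)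
  ultimately show "D \<subseteq> topspace X \<and> (\<forall>d\<in>D. \<exists>U. openin X U \<and> U \<inter> D = {d})"
    by blast
next
  assume D: "D \<subseteq> topspace X \<and> (\<forall>d\<in>D. \<exists>U. openin X U \<and> U \<inter> D = {d})"
  then have "openin (subtopology X D) {d}" if "d \<in> D" for d
    using that by (metis openin_subtopology)
  then have "discrete_topology D = subtopology X D"
    using D by (subst discrete_topology_unique) (auto simp: topspace_subtopology_subset)
  then show "discrete_subspace X D"
    by (simp add: discrete_subspace_def)
qed

text \<open>Closed and discrete in one condition, which is visibly inherited by subsets.\<close>

definition closed_discrete :: "'a topology \<Rightarrow> 'a set \<Rightarrow> bool"
  where "closed_discrete X D \<longleftrightarrow> (\<forall>S. S \<subseteq> D \<longrightarrow> closedin X S)"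

lemma closed_discrete_subset: "closed_discrete X D \<Longrightarrow> E \<subseteq> D \<Longrightarrow> closed_discrete X E"
  by (auto simp: closed_discrete_def)

lemma closed_discrete_imp_closedin: "closed_discrete X D \<Longrightarrow> closedin X D"
  by (auto simp: closed_discrete_def)

lemma closed_discrete_imp_discrete_subspace:
  assumes "closed_discrete X D"
  shows "discrete_subspace X D"
  unfolding discrete_subspace_iff
proof (intro conjI ballI)
  show D: "D \<subseteq> topspace X"
    using assms closed_discrete_imp_closedin closedin_subset by blast
  fix d assume "d \<in> D"
  then have "openin X (topspace X - (D - {d}))" "(topspace X - (D - {d})) \<inter> D = {d}"
    using assms D by (auto simp: closed_discrete_def)
  then show "\<exists>U. openin X U \<and> U \<inter> D = {d}"
    by blast
qed

lemma compactin_indexed_subcover: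
  assumes "compactin X K" "\<And>i. i \<in> A \<Longrightarrow> openin X (U i)" "K \<subseteq> (\<Union>i\<in>A. U i)"
  obtains B where "finite B" "B \<subseteq> A" "K \<subseteq> (\<Union>i\<in>B. U i)"
proof -
  obtain \<F> where "finite \<F>" "\<F> \<subseteq> U ` A" "K \<subseteq> \<Union>\<F>"
    using compactinD[OF assms(1), of "U ` A"] assms(2,3) by auto
  then show thesis
    using that finite_subset_image[of \<F> U A] by auto
qed

text \<open>By disjointness, a finite subcover of \<open>K\<close> leaves no point of
  \<open>K\<close> to the other members.\<close>

lemma compactin_disjoint_open_cover:
  assumes "compactin X K" "\<And>d. d \<in> D \<Longrightarrow> openin X (U d)" "K \<subseteq> (\<Union>d\<in>D. U d)" "disjoint_family_on U D"
  shows "finite {d \<in> D. U d \<inter> K \<noteq> {}}"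
proof -
  obtain B where B: "finite B" "B \<subseteq> D" "K \<subseteq> (\<Union>d\<in>B. U d)"
    using compactin_indexed_subcover[OF assms(1-3)] by blast
  have "{d \<in> D. U d \<inter> K \<noteq> {}} \<subseteq> B"
    using B assms(4) by (fastforce simp: disjoint_family_on_def)
  then show ?thesis
    using B(1) finite_subset by blast
qed

lemma closed_discrete_compactin_imp_finite:
  assumes "closed_discrete X D" "compactin X D"
  shows "finite D"
proof -
  have "\<forall>d\<in>D. \<exists>U. openin X U \<and> U \<inter> D = {d}"
    using closed_discrete_imp_discrete_subspace[OF assms(1)] by (simp add: discrete_subspace_iff)
  then obtain U where U: "\<And>d. d \<in> D \<Longrightarrow> openin X (U d) \<and> U d \<inter> D = {d}"
    by metis
  have "D \<subseteq> (\<Union>d\<in>D. U d)"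
    using U by blast
  then obtain B where "finite B" "B \<subseteq> D" "D \<subseteq> (\<Union>d\<in>B. U d)"
    using compactin_indexed_subcover[OF assms(2), of D U] U by metis
  moreover have "D \<subseteq> B"
  proof
    fix d assume "d \<in> D"
    then obtain b where b: "b \<in> B" "d \<in> U b"
      using calculation by blast
    then have "d \<in> U b \<inter> D" "b \<in> D"
      using calculation \<open>d \<in> D\<close> by auto
    then show "d \<in> B"
      using U[of b] b(1) by simp
  qed
  ultimately show ?thesis
    using finite_subset by blast
qed

lemma star_small_components:
  assumes K: "infinite K" and star: "\<And>J. J \<in> \<J> \<Longrightarrow> {J' \<in> \<J>. J' \<inter> J \<noteq> {}} \<lesssim> K"
  obtains \<C> where "\<Union>\<C> = \<J>" "\<And>\<A>. \<A> \<in> \<C> \<Longrightarrow> \<A> \<lesssim> K"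
    "\<And>\<A> \<B>. \<A> \<in> \<C> \<Longrightarrow> \<B> \<in> \<C> \<Longrightarrow> \<A> \<noteq> \<B> \<Longrightarrow> \<Union>\<A> \<inter> \<Union>\<B> = {}"
proof -
  \<comment> \<open>Sets are linked when they meet, and the components are the classes of
    \<open>R\<^sup>*\<close>. The empty set is linked to nothing, but reflexivity makes it a class
    of its own.\<close>
  define R where "R = {(J, J'). J \<in> \<J> \<and> J' \<in> \<J> \<and> J' \<inter> J \<noteq> {}}"
  have "sym R"
    by (auto simp: R_def sym_def)
  then have symR: "sym (R\<^sup>*)"
    by (rule sym_rtrancl)
  have cls: "R\<^sup>* `` {I} = R\<^sup>* `` {J}" if "(I, J) \<in> R\<^sup>*" for I J
    using that symR by (auto dest: symD intro: rtrancl_trans)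
  have inJ: "J' \<in> \<J>" if "(J, J') \<in> R\<^sup>*" "J \<in> \<J>" for J J'
    using that by (induction rule: rtrancl_induct) (auto simp: R_def)
  have small: "R `` {J} \<lesssim> K" for J
  proof (cases "J \<in> \<J>")
    case True
    then have "R `` {J} = {J' \<in> \<J>. J' \<inter> J \<noteq> {}}"
      by (auto simp: R_def)
    then show ?thesis
      using star[OF True] by simp
  next
    case False
    then have "R `` {J} = {}"
      by (auto simp: R_def)
    then show ?thesis
      by simp
  qed
  show thesis
  proof (rule that[of "(\<lambda>J. R\<^sup>* `` {J}) ` \<J>"])
    show "\<Union>((\<lambda>J. R\<^sup>* `` {J}) ` \<J>) = \<J>"
      using inJ by auto
    show "\<A> \<lesssim> K" if "\<A> \<in> (\<lambda>J. R\<^sup>* `` {J}) ` \<J>" for \<A>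
      using that rtrancl_Image_lepoll[OF K small] by auto
    fix \<A> \<B>
    assume "\<A> \<in> (\<lambda>J. R\<^sup>* `` {J}) ` \<J>" "\<B> \<in> (\<lambda>J. R\<^sup>* `` {J}) ` \<J>" and ne: "\<A> \<noteq> \<B>"
    then obtain I J where I: "I \<in> \<J>" "\<A> = R\<^sup>* `` {I}" and J: "J \<in> \<J>" "\<B> = R\<^sup>* `` {J}"
      by blast
    show "\<Union>\<A> \<inter> \<Union>\<B> = {}"
    proof (rule ccontr)
      assume "\<Union>\<A> \<inter> \<Union>\<B> \<noteq> {}"
      then obtain x I' J' where x: "x \<in> I'" "x \<in> J'" and I': "(I, I') \<in> R\<^sup>*" and J': "(J, J') \<in> R\<^sup>*"
        using I J by blast
      have "(I', J') \<in> R"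
        using x inJ[OF I' I(1)] inJ[OF J' J(1)] by (auto simp: R_def)
      then have "R\<^sup>* `` {I'} = R\<^sup>* `` {J'}"
        by (intro cls) auto
      then show False
        using ne cls[OF I'] cls[OF J'] I J by simp
    qed
  qed
qed

text \<open>Regularity gives \<open>A x \<subseteq> C x \<subseteq> U x\<close> around each point,
  and countably many \<open>A\<close> cover \<open>Q\<close>. Subtracting the earlier
  \<open>C\<close> from each \<open>U\<close> keeps a point in the first \<open>U\<close> that
  contains it, and all later sets miss \<open>A (b n)\<close>, which gives local finiteness. The
  condition \<open>W \<subseteq> Q\<close> lets refinements on disjoint sets \<open>Q\<close> be
  combined.\<close>

lemma Lindelof_open_cover_locally_finite:
  assumes reg: "regular_space X" and Q: "openin X Q" "Lindelof_space (subtopology X Q)"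
    and \<U>: "\<And>U. U \<in> \<U> \<Longrightarrow> openin X U" "Q \<subseteq> \<Union>\<U>"
  obtains V :: "nat \<Rightarrow> 'a set"
    where "\<And>n. openin X (V n)" "(\<Union>n. V n) = Q" "\<And>n. V n \<noteq> {} \<Longrightarrow> \<exists>U\<in>\<U>. V n \<subseteq> U"
      "\<And>x. x \<in> Q \<Longrightarrow> \<exists>W. openin X W \<and> x \<in> W \<and> W \<subseteq> Q \<and> finite {n. V n \<inter> W \<noteq> {}}"
proof (cases "Q = {}")
  case True
  \<comment> \<open>Here \<open>\<U>\<close> may be empty, so an empty \<open>V n\<close> need not
    lie in any member; hence the guard \<open>V n \<noteq> {}\<close>.\<close>
  then show thesis
    by (intro that[of "\<lambda>n. {}"]) auto
next
  case False
  have "\<exists>U A C. U \<in> \<U> \<and> openin X A \<and> closedin X C \<and> x \<in> A \<and> A \<subseteq> C \<and> C \<subseteq> U \<inter> Q"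
    if x: "x \<in> Q" for x
  proof -
    obtain U where U: "U \<in> \<U>" "x \<in> U"
      using \<U>(2) x by blast
    have "neighbourhood_base_of (closedin X) X"
      using reg by (simp add: neighbourhood_base_of_closedin)
    moreover have "openin X (U \<inter> Q)" "x \<in> U \<inter> Q"
      using U x \<U>(1) Q(1) by auto
    ultimately obtain A C where "openin X A" "closedin X C" "x \<in> A" "A \<subseteq> C" "C \<subseteq> U \<inter> Q"
      unfolding neighbourhood_base_of by metis
    then show ?thesis
      using U by blast
  qed
  then obtain U A C where UAC: "\<And>x. x \<in> Q \<Longrightarrow> U x \<in> \<U> \<and> openin X (A x) \<and> closedin X (C x) \<and>
      x \<in> A x \<and> A x \<subseteq> C x \<and> C x \<subseteq> U x \<inter> Q"
    by metis
  have "Q \<subseteq> topspace X"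
    using Q(1) openin_subset by blast
  then have "\<exists>\<V>. countable \<V> \<and> \<V> \<subseteq> A ` Q \<and> Q \<subseteq> \<Union>\<V>"
    using Q(2) UAC unfolding Lindelof_space_subtopology_subset[OF \<open>Q \<subseteq> topspace X\<close>]
    by (elim allE[of _ "A ` Q"]) auto
  then obtain B where B: "countable B" "B \<subseteq> Q" "Q \<subseteq> (\<Union>x\<in>B. A x)"
    by (metis countable_subset_image)
  then have "B \<noteq> {}"
    using False by blast
  then obtain b :: "nat \<Rightarrow> 'a" where b: "range b = B"
    using B(1) by (metis range_from_nat_into)
  then have bQ: "b n \<in> Q" for n
    using B(2) by blast
  define V where "V n = U (b n) \<inter> Q - (\<Union>k<n. C (b k))" for n
  show thesis
  proof (rule that[of V])
    show "openin X (V n)" for n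
      unfolding V_def using UAC[OF bQ] \<U>(1) Q(1) by (intro openin_diff closedin_Union openin_Int) auto
    show "(\<Union>n. V n) = Q"
    proof
      show "Q \<subseteq> (\<Union>n. V n)"
      proof
        fix y assume y: "y \<in> Q"
        then obtain n where "y \<in> A (b n)"
          using B(3) b by blast
        then have n: "y \<in> U (b n)"
          using UAC[OF bQ[of n]] by blast
        define m where "m = (LEAST m. y \<in> U (b m))"
        have "y \<in> U (b m)" "\<And>k. k < m \<Longrightarrow> y \<notin> U (b k)"
          unfolding m_def using n by (rule LeastI) (rule not_less_Least)
        then have "y \<in> V m"
          using y UAC[OF bQ] by (fastforce simp: V_def)
        then show "y \<in> (\<Union>n. V n)"
          by blast
      qed
    qed (auto simp: V_def)
    show "\<exists>U\<in>\<U>. V n \<subseteq> U" for n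
      using UAC[OF bQ[of n]] by (auto simp: V_def)
    fix x assume "x \<in> Q"
    then obtain n where n: "x \<in> A (b n)"
      using B(3) b by blast
    have "V m \<inter> A (b n) = {}" if "n < m" for m
      using that UAC[OF bQ[of n]] by (auto simp: V_def)
    then have "{m. V m \<inter> A (b n) \<noteq> {}} \<subseteq> {..n}"
      by (blast intro: leI)
    then have "finite {m. V m \<inter> A (b n) \<noteq> {}}"
      using finite_subset by blast
    then show "\<exists>W. openin X W \<and> x \<in> W \<and> W \<subseteq> Q \<and> finite {n. V n \<inter> W \<noteq> {}}"
      using UAC[OF bQ[of n]] n by (intro exI[of _ "A (b n)"]) auto
  qed
qed

lemma paracompact_space_disjoint_Lindelof:
  assumes reg: "regular_space X" and disj: "disjoint \<Q>" and cover: "\<Union>\<Q> = topspace X"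
    and Q: "\<And>Q. Q \<in> \<Q> \<Longrightarrow> openin X Q" "\<And>Q. Q \<in> \<Q> \<Longrightarrow> Lindelof_space (subtopology X Q)"
  shows "paracompact_space X"
  unfolding paracompact_space_def
proof (intro allI impI)
  fix \<U> assume \<U>: "(\<forall>U\<in>\<U>. openin X U) \<and> \<Union>\<U> = topspace X"
  define good where "good Q V \<longleftrightarrow> (\<forall>n. openin X (V n)) \<and> (\<Union>n. V n) = Q \<and>
      (\<forall>n. V n \<noteq> {} \<longrightarrow> (\<exists>U\<in>\<U>. V n \<subseteq> U)) \<and>
      (\<forall>x\<in>Q. \<exists>W. openin X W \<and> x \<in> W \<and> W \<subseteq> Q \<and> finite {n. V n \<inter> W \<noteq> {}})"
    for Q and V :: "nat \<Rightarrow> 'a set"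
  have "\<exists>V. good Q V" if Q': "Q \<in> \<Q>" for Q
  proof -
    have "Q \<subseteq> \<Union>\<U>"
      using \<U> cover Q' by blast
    with \<U> obtain V :: "nat \<Rightarrow> 'a set"
      where "\<And>n. openin X (V n)" "(\<Union>n. V n) = Q" "\<And>n. V n \<noteq> {} \<Longrightarrow> \<exists>U\<in>\<U>. V n \<subseteq> U"
      "\<And>x. x \<in> Q \<Longrightarrow> \<exists>W. openin X W \<and> x \<in> W \<and> W \<subseteq> Q \<and> finite {n. V n \<inter> W \<noteq> {}}"
      using Lindelof_open_cover_locally_finite[OF reg Q(1)[OF Q'] Q(2)[OF Q'], of \<U>] by metis
    then show ?thesis
      unfolding good_def by blast
  qed
  then obtain V where V: "\<And>Q. Q \<in> \<Q> \<Longrightarrow> good Q (V Q)"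
    by metis
  have op: "openin X (V Q n)" if "Q \<in> \<Q>" for Q n
    using V[OF that] by (simp add: good_def)
  have UnV: "(\<Union>n. V Q n) = Q" if "Q \<in> \<Q>" for Q
    using V[OF that] by (simp add: good_def)
  have ref: "\<exists>U\<in>\<U>. V Q n \<subseteq> U" if "Q \<in> \<Q>" "V Q n \<noteq> {}" for Q n
    using V[OF that(1)] that(2) by (simp add: good_def)
  have lf: "\<exists>W. openin X W \<and> x \<in> W \<and> W \<subseteq> Q \<and> finite {n. V Q n \<inter> W \<noteq> {}}"
    if "Q \<in> \<Q>" "x \<in> Q" for Q x
    using V[OF that(1)] that(2) by (simp add: good_def)
  define \<V> where "\<V> = {V Q n | Q n. Q \<in> \<Q> \<and> V Q n \<noteq> {}}"
  have Un: "\<Union>\<V> = topspace X"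
  proof -
    have "\<Union>\<V> = (\<Union>Q\<in>\<Q>. \<Union>n. V Q n)"
      by (auto simp: \<V>_def)
    then show ?thesis
      using UnV cover by auto
  qed
  have "locally_finite_in X \<V>"
    unfolding locally_finite_in_def
  proof (intro conjI ballI)
    fix x assume "x \<in> topspace X"
    then obtain Q where Q: "Q \<in> \<Q>" "x \<in> Q"
      using cover by blast
    then obtain W where W: "openin X W" "x \<in> W" "W \<subseteq> Q" and fin: "finite {n. V Q n \<inter> W \<noteq> {}}"
      using lf by blast
    have "{U \<in> \<V>. U \<inter> W \<noteq> {}} \<subseteq> V Q ` {n. V Q n \<inter> W \<noteq> {}}"
    proof
      fix U assume "U \<in> {U \<in> \<V>. U \<inter> W \<noteq> {}}"
      then obtain Q' n where U: "U = V Q' n" "Q' \<in> \<Q>" "V Q' n \<inter> W \<noteq> {}"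
        by (auto simp: \<V>_def)
      have "V Q' n \<subseteq> Q'"
        using UnV[OF U(2)] by blast
      then have "Q' \<inter> Q \<noteq> {}"
        using U(3) W(3) by blast
      then have "Q' = Q"
        using disj U(2) Q(1) by (auto simp: pairwise_def disjnt_def)
      then show "U \<in> V Q ` {n. V Q n \<inter> W \<noteq> {}}"
        using U by blast
    qed
    then have "finite {U \<in> \<V>. U \<inter> W \<noteq> {}}"
      using fin finite_surj by blast
    then show "\<exists>V. openin X V \<and> x \<in> V \<and> finite {U \<in> \<V>. U \<inter> V \<noteq> {}}"
      using W by blast
  qed (simp add: Un)
  moreover have "\<forall>V\<in>\<V>. openin X V" "\<forall>V\<in>\<V>. \<exists>U\<in>\<U>. V \<subseteq> U"
    unfolding \<V>_def using op ref by blast+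
  ultimately show "\<exists>\<V>. (\<forall>V\<in>\<V>. openin X V) \<and> \<Union>\<V> = topspace X \<and>
      (\<forall>V\<in>\<V>. \<exists>U\<in>\<U>. V \<subseteq> U) \<and> locally_finite_in X \<V>"
    using Un by blast
qed

section \<open>Locally compact perfectly normal spaces\<close>

locale locally_compact_perfectly_normal =
  fixes X :: "'a topology"
  assumes Hausdorff: "Hausdorff_space X"
    and locally_compact: "locally_compact_space X"
    and perfectly_normal: "perfectly_normal_space X"
begin

lemma normal: "normal_space X"
  using perfectly_normal by (simp add: perfectly_normal_space_def)

lemma regular: "regular_space X"
  using locally_compact_Hausdorff_imp_regular_space Hausdorff locally_compact by blast

lemma closedin_singleton: "x \<in> topspace X \<Longrightarrow> closedin X {x}"
  using Hausdorff by (simp add: closedin_Hausdorff_singleton)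

lemma openin_eq_UN_closedin:
  assumes "openin X U"
  obtains C :: "nat \<Rightarrow> 'a set" where "\<And>n. closedin X (C n)" "(\<Union>n. C n) = U"
proof -
  have "closedin X (topspace X - U)"
    using assms by blast
  then have "fsigma_in X U"
    using perfectly_normal openin_subset[OF assms]
    by (auto simp: perfectly_normal_space_def fsigma_in_gdelta_in)
  then show thesis
    using that unfolding fsigma_in_ascending by blast
qed

lemma compact_neighbourhood:
  assumes "openin X U" "x \<in> U"
  obtains V K where "openin X V" "compactin X K" "closedin X K" "x \<in> V" "V \<subseteq> K" "K \<subseteq> U"
proof -
  have "neighbourhood_base_of (\<lambda>C. compactin X C \<and> closedin X C) X"
    using Hausdorff locally_compact locally_compact_space_neighbourhood_base_closedin by blast
  then show thesis
    using assms that unfolding neighbourhood_base_of by metis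
qed

lemma relatively_compact_neighbourhood:
  assumes "x \<in> topspace X"
  obtains V where "openin X V" "x \<in> V" "compactin X (X closure_of V)"
  using assms Hausdorff locally_compact locally_compact_space_compact_closure_of by metis

lemma compactin_open_superset:
  assumes "compactin X K"
  obtains U where "openin X U" "K \<subseteq> U" "compactin X (X closure_of U)"
proof -
  obtain U L where U: "openin X U" "compactin X L" "closedin X L" "K \<subseteq> U" "U \<subseteq> L"
    using assms Hausdorff locally_compact locally_compact_space_compact_closed_compact by metis
  then have "compactin X (X closure_of U)"
    by (meson closed_compactin closedin_closure_of closure_of_minimal)
  then show thesis
    using that U by blast
qed

text \<open>A point is a G-delta, so compact neighbourhoods \<open>K n\<close> can be chosen with
  intersection \<open>{x}\<close>. For open \<open>U\<close> around \<open>x\<close> their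
  complements cover the compact set \<open>K 0 - U\<close>, hence finitely many do. Index 0 occurs
  in every \<open>\<Inter>k\<le>n. V k\<close>, which keeps it inside \<open>K 0\<close>.\<close>

lemma first_countable: "first_countable X"
  unfolding first_countable_def
proof
  fix x assume x: "x \<in> topspace X"
  then have "gdelta_in X {x}"
    using perfectly_normal closedin_singleton by (simp add: perfectly_normal_space_def)
  then obtain C :: "nat \<Rightarrow> 'a set" where C: "\<And>n. openin X (C n)" "(\<Inter>n. C n) = {x}"
    unfolding gdelta_in_descending by blast
  have "\<exists>V K. openin X V \<and> compactin X K \<and> closedin X K \<and> x \<in> V \<and> V \<subseteq> K \<and> K \<subseteq> C n" for n
    using compact_neighbourhood[OF C(1), of x n] C(2) by (metis INT_iff UNIV_I singletonI)
  then obtain V K where VK: "\<And>n. openin X (V n)" "\<And>n. compactin X (K n)" "\<And>n. closedin X (K n)"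
      "\<And>n. x \<in> V n" "\<And>n. V n \<subseteq> K n" "\<And>n. K n \<subseteq> C n"
    by metis
  define \<B> where "\<B> = range (\<lambda>n. \<Inter>k\<le>n. V k)"
  have "\<exists>B\<in>\<B>. x \<in> B \<and> B \<subseteq> U" if U: "openin X U" "x \<in> U" for U
  proof -
    have "compactin X (K 0 - U)"
      using VK(2,3) U(1) by (metis Diff_subset closed_compactin closedin_diff)
    moreover have "K 0 - U \<subseteq> (\<Union>n\<in>UNIV. topspace X - K n)"
    proof
      fix y assume y: "y \<in> K 0 - U"
      then have "y \<noteq> x"
        using U by blast
      then obtain n where "y \<notin> C n"
        using C(2) by blast
      moreover have "y \<in> topspace X"
        using y VK(3)[of 0] closedin_subset by blast
      ultimately show "y \<in> (\<Union>n\<in>UNIV. topspace X - K n)"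
        using VK(6) by blast
    qed
    moreover have "openin X (topspace X - K n)" for n
      using VK(3) by blast
    ultimately obtain I where I: "finite I" "K 0 - U \<subseteq> (\<Union>n\<in>I. topspace X - K n)"
      using compactin_indexed_subcover[of X "K 0 - U" UNIV "\<lambda>n. topspace X - K n"] by metis
    obtain n where n: "I \<subseteq> {..n}"
      using I(1) finite_nat_iff_bounded_le by blast
    have "(\<Inter>k\<le>n. V k) \<subseteq> U"
    proof
      fix y assume y: "y \<in> (\<Inter>k\<le>n. V k)"
      then have "y \<in> K k" if "k \<le> n" for k
        using VK(5) that by blast
      then show "y \<in> U"
        using I(2) n by blast
    qed
    moreover have "x \<in> (\<Inter>k\<le>n. V k)" "(\<Inter>k\<le>n. V k) \<in> \<B>"
      using VK(4) by (auto simp: \<B>_def)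
    ultimately show ?thesis
      by blast
  qed
  moreover have "openin X B" if "B \<in> \<B>" for B
    using that VK(1) by (auto simp: \<B>_def intro!: openin_Inter)
  moreover have "countable \<B>"
    by (simp add: \<B>_def)
  ultimately show "\<exists>\<B>. countable \<B> \<and> (\<forall>V\<in>\<B>. openin X V) \<and>
      (\<forall>U. openin X U \<and> x \<in> U \<longrightarrow> (\<exists>V\<in>\<B>. x \<in> V \<and> V \<subseteq> U))"
    by blast
qed

lemma countably_tight: "countably_tight X"
  unfolding countably_tight_def
proof (intro allI impI)
  fix A x assume *: "A \<subseteq> topspace X \<and> x \<in> X closure_of A"
  then have "x \<in> topspace X"
    by (simp add: in_closure_of)
  then obtain \<B> where \<B>: "countable \<B>" "\<And>V. V \<in> \<B> \<Longrightarrow> openin X V"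
    "\<And>U. openin X U \<Longrightarrow> x \<in> U \<Longrightarrow> \<exists>V\<in>\<B>. x \<in> V \<and> V \<subseteq> U"
    using first_countable unfolding first_countable_def by metis
  have "\<exists>a. a \<in> A \<and> a \<in> V" if "V \<in> {V \<in> \<B>. x \<in> V}" for V
    using * that \<B>(2) by (auto simp: in_closure_of)
  then obtain a where a: "\<And>V. V \<in> {V \<in> \<B>. x \<in> V} \<Longrightarrow> a V \<in> A \<and> a V \<in> V"
    by metis
  let ?B = "a ` {V \<in> \<B>. x \<in> V}"
  have "x \<in> X closure_of ?B"
    unfolding in_closure_of
  proof (intro conjI allI impI)
    fix T assume "x \<in> T \<and> openin X T"
    then obtain V where "V \<in> \<B>" "x \<in> V" "V \<subseteq> T"
      using \<B>(3) by blast
    then show "\<exists>y. y \<in> ?B \<and> y \<in> T"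
      using a by blast
  qed fact
  moreover have "countable ?B" "?B \<subseteq> A"
    using \<B>(1) a by auto
  ultimately show "\<exists>B\<subseteq>A. countable B \<and> x \<in> X closure_of B"
    by blast
qed

text \<open>Hereditary Lindelofness of compact sets: the union of the family is an F-sigma, so its
  trace on \<open>K\<close> is a countable union of compact sets.\<close>

lemma compactin_countable_subcover:
  assumes "compactin X K" "\<And>i. i \<in> A \<Longrightarrow> openin X (U i)"
  obtains B where "countable B" "B \<subseteq> A" "K \<inter> (\<Union>i\<in>A. U i) \<subseteq> (\<Union>i\<in>B. U i)"
proof -
  have "openin X (\<Union>i\<in>A. U i)"
    using assms(2) by blast
  then obtain C :: "nat \<Rightarrow> 'a set" where C: "\<And>n. closedin X (C n)" "(\<Union>n. C n) = (\<Union>i\<in>A. U i)"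
    using openin_eq_UN_closedin by metis
  have "\<exists>B. finite B \<and> B \<subseteq> A \<and> C n \<inter> K \<subseteq> (\<Union>i\<in>B. U i)" for n
  proof -
    have "C n \<inter> K \<subseteq> (\<Union>i\<in>A. U i)"
      using C(2) by blast
    then obtain B where "finite B" "B \<subseteq> A" "C n \<inter> K \<subseteq> (\<Union>i\<in>B. U i)"
      using compactin_indexed_subcover[OF closed_Int_compactin[OF C(1) assms(1)], of A U n] assms(2)
      by auto
    then show ?thesis
      by blast
  qed
  then obtain B where B: "\<And>n. finite (B n)" "\<And>n. B n \<subseteq> A" "\<And>n. C n \<inter> K \<subseteq> (\<Union>i\<in>B n. U i)"
    by metis
  show thesis
  proof (rule that[of "\<Union>n. B n"])
    show "countable (\<Union>n. B n)"
      using B(1) by (intro countable_UN) (auto intro: countable_finite)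
    show "(\<Union>n. B n) \<subseteq> A"
      using B(2) by blast
    have "K \<inter> (\<Union>i\<in>A. U i) \<subseteq> (\<Union>n. C n \<inter> K)"
      using C(2) by blast
    also have "\<dots> \<subseteq> (\<Union>i\<in>(\<Union>n. B n). U i)"
      using B(3) by blast
    finally show "K \<inter> (\<Union>i\<in>A. U i) \<subseteq> (\<Union>i\<in>(\<Union>n. B n). U i)" .
  qed
qed

text \<open>A right-separated family in a hereditarily Lindelof set is countable.\<close>

lemma countable_new_points:
  assumes K: "compactin X K" and U: "\<And>i. i \<in> A \<Longrightarrow> openin X (U i)"
    and R: "wf R" "\<And>i j. i \<noteq> j \<Longrightarrow> (i, j) \<in> R \<or> (j, i) \<in> R"
  shows "countable {i \<in> A. K \<inter> (U i - (\<Union>j\<in>{j \<in> A. (j, i) \<in> R}. U j)) \<noteq> {}}"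
    (is "countable ?B")
proof -
  \<comment> \<open>If all initial segments of \<open>S\<close> are countable, so is
    \<open>S\<close>: choose a countable \<open>T\<close> with the same union on \<open>K\<close>. A
    point that is new at \<open>i\<close> lies in some \<open>U j\<close> with
    \<open>j \<in> T\<close>, so \<open>j\<close> cannot precede \<open>i\<close>. This is applied
    to initial segments inside a well-founded induction and then to the whole set.\<close>
  have step: "countable S" if S: "S \<subseteq> ?B" "\<And>j. j \<in> S \<Longrightarrow> countable {i \<in> S. (i, j) \<in> R}" for S
  proof -
    have "openin X (U i)" if "i \<in> S" for i
      using that S(1) U by blast
    then obtain T where T: "countable T" "T \<subseteq> S" "K \<inter> (\<Union>i\<in>S. U i) \<subseteq> (\<Union>i\<in>T. U i)"
      using compactin_countable_subcover[OF K, of S U] by metis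
    have "S \<subseteq> (\<Union>j\<in>T. insert j {i \<in> S. (i, j) \<in> R})"
    proof
      fix i assume i: "i \<in> S"
      then obtain y where y: "y \<in> K" "y \<in> U i" "\<And>j. j \<in> A \<Longrightarrow> (j, i) \<in> R \<Longrightarrow> y \<notin> U j"
        using S(1) by blast
      then obtain j where j: "j \<in> T" "y \<in> U j"
        using T(3) i by blast
      then have "j \<in> A"
        using T(2) S(1) by blast
      then have "i = j \<or> (i, j) \<in> R"
        using y(3) j(2) R(2) by blast
      then show "i \<in> (\<Union>j\<in>T. insert j {i \<in> S. (i, j) \<in> R})"
        using i j(1) by blast
    qed
    moreover have "countable (\<Union>j\<in>T. insert j {i \<in> S. (i, j) \<in> R})"
      using T(1,2) S(2) by (intro countable_UN countable_insert) auto
    ultimately show ?thesis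
      by (rule countable_subset)
  qed
  have init: "countable {i \<in> ?B. (i, j) \<in> R}" for j
    using R(1)
  proof (induction j rule: wf_induct_rule)
    case (less j)
    show ?case
    proof (rule step)
      fix k assume "k \<in> {i \<in> ?B. (i, j) \<in> R}"
      then have "(k, j) \<in> R"
        by blast
      then have "countable {i \<in> ?B. (i, k) \<in> R}"
        by (rule less.IH)
      then show "countable {i \<in> {i \<in> ?B. (i, j) \<in> R}. (i, k) \<in> R}"
        by (rule countable_subset[rotated]) blast
    qed blast
  qed
  show ?thesis
    using init by (rule step[OF subset_refl])
qed

text \<open>The union of isolating neighbourhoods is an F-sigma, the union of closed sets
  \<open>C n\<close>. A limit of a subset of \<open>D \<inter> C n\<close> stays in
  \<open>C n\<close>, hence lies in some \<open>U d\<close>, and \<open>d\<close> is the only point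
  of \<open>D\<close> there.\<close>

lemma discrete_eq_UN_closed_discrete:
  assumes "discrete_subspace X D"
  obtains F :: "nat \<Rightarrow> 'a set" where "\<And>n. closed_discrete X (F n)" "(\<Union>n. F n) = D"
proof -
  have DX: "D \<subseteq> topspace X" and "\<forall>d\<in>D. \<exists>U. openin X U \<and> U \<inter> D = {d}"
    using assms by (auto simp: discrete_subspace_iff)
  then obtain U where U: "\<And>d. d \<in> D \<Longrightarrow> openin X (U d)" "\<And>d. d \<in> D \<Longrightarrow> U d \<inter> D = {d}"
    by metis
  have dU: "d \<in> U d" if "d \<in> D" for d
    using U(2)[OF that] by blast
  have "openin X (\<Union>d\<in>D. U d)"
    using U(1) by blast
  then obtain C :: "nat \<Rightarrow> 'a set" where C: "\<And>n. closedin X (C n)" "(\<Union>n. C n) = (\<Union>d\<in>D. U d)"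
    using openin_eq_UN_closedin by metis
  have "closed_discrete X (D \<inter> C n)" for n
    unfolding closed_discrete_def
  proof (intro allI impI)
    fix S assume S: "S \<subseteq> D \<inter> C n"
    have "X closure_of S \<subseteq> S"
    proof
      fix y assume y: "y \<in> X closure_of S"
      then have "y \<in> C n"
        using C(1) S by (meson closure_of_minimal le_inf_iff subsetD)
      then obtain d where d: "d \<in> D" "y \<in> U d"
        using C(2) by blast
      have "y = d"
      proof (rule ccontr)
        assume "y \<noteq> d"
        moreover have "openin X (U d - {d})"
          using U(1) d(1) DX closedin_singleton by blast
        ultimately obtain s where "s \<in> S" "s \<in> U d - {d}"
          using y d(2) unfolding in_closure_of by (metis DiffI singletonD)
        then show False
          using U(2)[OF d(1)] S by blast
      qed
      moreover obtain s where "s \<in> S" "s \<in> U d"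
        using y d U(1) by (auto simp: in_closure_of)
      moreover have "s \<in> U d \<inter> D" if "s \<in> S" "s \<in> U d" for s
        using that S by blast
      ultimately show "y \<in> S"
        using U(2)[OF d(1)] by auto
    qed
    moreover have "S \<subseteq> topspace X"
      using S DX by blast
    ultimately show "closedin X S"
      by (metis closedin_closure_of closure_of_subset subset_antisym)
  qed
  moreover have "(\<Union>n. D \<inter> C n) = D"
    using C(2) dU by blast
  ultimately show thesis
    by (rule that)
qed

end

section \<open>Open expansions of closed discrete sets\<close>

locale cwH_locally_compact_perfectly_normal = locally_compact_perfectly_normal +
  assumes cwH: "collectionwise_Hausdorff X"
begin

text \<open>Disjoint open sets may still accumulate outside their union. Normality gives
  \<open>V\<close> around \<open>D\<close> whose closure lies inside the union; on the compact set
  \<open>X closure_of V \<inter> K\<close> the disjoint sets form a cover, so only finitely many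
  meet it.\<close>

lemma closed_discrete_expansion:
  assumes D: "closed_discrete X D"
  obtains J where "\<And>d. d \<in> D \<Longrightarrow> openin X (J d)" "\<And>d. d \<in> D \<Longrightarrow> d \<in> J d"
    "\<And>K. compactin X K \<Longrightarrow> finite {d \<in> D. J d \<inter> K \<noteq> {}}"
proof -
  have "closedin X D" "discrete_subspace X D"
    using D closed_discrete_imp_closedin closed_discrete_imp_discrete_subspace by auto
  then obtain U where U: "\<And>d. d \<in> D \<Longrightarrow> openin X (U d)" "\<And>d. d \<in> D \<Longrightarrow> d \<in> U d"
      "disjoint_family_on U D"
    using cwH unfolding collectionwise_Hausdorff_def by metis
  have "openin X (\<Union>d\<in>D. U d)" "D \<subseteq> (\<Union>d\<in>D. U d)"
    using U(1,2) by auto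
  then obtain V where V: "openin X V" "D \<subseteq> V" "X closure_of V \<subseteq> (\<Union>d\<in>D. U d)"
    using normal \<open>closedin X D\<close> unfolding normal_space_alt by metis
  show thesis
  proof (rule that[of "\<lambda>d. V \<inter> U d"])
    show "openin X (V \<inter> U d)" "d \<in> V \<inter> U d" if "d \<in> D" for d
      using that U V by auto
    fix K assume "compactin X K"
    then have "compactin X (X closure_of V \<inter> K)"
      by (simp add: closed_Int_compactin)
    then have "finite {d \<in> D. U d \<inter> (X closure_of V \<inter> K) \<noteq> {}}"
      by (rule compactin_disjoint_open_cover) (use U V(3) in auto)
    moreover have "V \<subseteq> X closure_of V"
      using V(1) by (simp add: closure_of_subset openin_subset)
    ultimately show "finite {d \<in> D. V \<inter> U d \<inter> K \<noteq> {}}"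
      by (elim finite_subset[rotated]) blast
  qed
qed

text \<open>The finite sets \<open>T k\<close> bound the number of members that meet
  \<open>K\<close> by the number of indices. The index type is left open because it is instantiated
  both by \<open>nat\<close> and by \<open>omega1 \<times> nat\<close>.\<close>

lemma UN_closed_discrete_expansion:
  fixes F :: "'k \<Rightarrow> 'a set"
  assumes F: "\<And>k. closed_discrete X (F k)"
  shows "\<exists>J. (\<forall>d\<in>\<Union>k. F k. openin X (J d) \<and> d \<in> J d) \<and>
    (\<forall>K. compactin X K \<longrightarrow>
      (\<exists>T. (\<forall>k :: 'k. finite (T k)) \<and> {d \<in> (\<Union>k. F k). J d \<inter> K \<noteq> {}} \<subseteq> (\<Union>k. T k)))"
proof -
  have "\<exists>G. (\<forall>d\<in>F k. openin X (G d) \<and> d \<in> G d) \<and>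
      (\<forall>K. compactin X K \<longrightarrow> finite {d \<in> F k. G d \<inter> K \<noteq> {}})" for k
  proof (rule closed_discrete_expansion[OF F[of k]])
    fix G assume "\<And>d. d \<in> F k \<Longrightarrow> openin X (G d)" "\<And>d. d \<in> F k \<Longrightarrow> d \<in> G d"
      "\<And>K. compactin X K \<Longrightarrow> finite {d \<in> F k. G d \<inter> K \<noteq> {}}"
    then show ?thesis
      by blast
  qed
  then have "\<forall>k. \<exists>G. (\<forall>d\<in>F k. openin X (G d) \<and> d \<in> G d) \<and>
      (\<forall>K. compactin X K \<longrightarrow> finite {d \<in> F k. G d \<inter> K \<noteq> {}})"
    by (rule allI)
  from choice[OF this] obtain G where G: "\<forall>k. (\<forall>d\<in>F k. openin X (G k d) \<and> d \<in> G k d) \<and>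
      (\<forall>K. compactin X K \<longrightarrow> finite {d \<in> F k. G k d \<inter> K \<noteq> {}})"
    by (rule exE)
  \<comment> \<open>A point may lie in several \<open>F k\<close>; \<open>\<kappa>\<close> selects
    the one whose expansion is used for it.\<close>
  obtain \<kappa> where \<kappa>: "\<And>d. d \<in> (\<Union>k. F k) \<Longrightarrow> d \<in> F (\<kappa> d)"
    by (metis UN_E)
  show ?thesis
  proof (intro exI[of _ "\<lambda>d. G (\<kappa> d) d"] conjI ballI allI impI)
    show "openin X (G (\<kappa> d) d)" "d \<in> G (\<kappa> d) d" if "d \<in> (\<Union>k. F k)" for d
      using G \<kappa>[OF that] by auto
    fix K assume "compactin X K"
    then have fin: "\<forall>k. finite {d \<in> F k. G k d \<inter> K \<noteq> {}}"
      using G by simp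
    have sub: "{d \<in> (\<Union>k. F k). G (\<kappa> d) d \<inter> K \<noteq> {}} \<subseteq> (\<Union>k. {d \<in> F k. G k d \<inter> K \<noteq> {}})"
    proof
      fix d assume d: "d \<in> {d \<in> (\<Union>k. F k). G (\<kappa> d) d \<inter> K \<noteq> {}}"
      then have "d \<in> F (\<kappa> d)"
        using \<kappa> by simp
      then show "d \<in> (\<Union>k. {d \<in> F k. G k d \<inter> K \<noteq> {}})"
        using d by blast
    qed
    show "\<exists>T. (\<forall>k :: 'k. finite (T k)) \<and> {d \<in> (\<Union>k. F k). G (\<kappa> d) d \<inter> K \<noteq> {}} \<subseteq> (\<Union>k. T k)"
      by (rule exI, rule conjI, rule fin, rule sub)
  qed
qed

end

section \<open>The one-point compactification\<close>

lemma inj_option_if_infinite: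
  assumes "infinite (UNIV :: 'a set)"
  obtains h :: "'a option \<Rightarrow> 'a" where "inj h"
proof -
  have "infinite (range (Some :: 'a \<Rightarrow> 'a option))"
    using assms by (simp add: finite_image_iff)
  then have "insert None (range (Some :: 'a \<Rightarrow> 'a option)) \<lesssim> range (Some :: 'a \<Rightarrow> 'a option)"
    by (rule infinite_insert_lepoll)
  also have "range (Some :: 'a \<Rightarrow> 'a option) \<lesssim> (UNIV :: 'a set)"
    by (rule image_lepoll)
  finally have "(UNIV :: 'a option set) \<lesssim> (UNIV :: 'a set)"
    by (simp add: UNIV_option_conv)
  then show thesis
    using that by (auto simp: lepoll_def)
qed

lemma countably_tightD:
  assumes "countably_tight X" "A \<subseteq> topspace X" "x \<in> X closure_of A"
  shows "\<exists>B\<subseteq>A. countable B \<and> x \<in> X closure_of B"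
  using assms unfolding countably_tight_def by simp

lemma homeomorphic_map_countably_tight:
  assumes h: "homeomorphic_map X Y h" and X: "countably_tight X"
  shows "countably_tight Y"
  unfolding countably_tight_def
proof (intro allI impI)
  fix A y assume *: "A \<subseteq> topspace Y \<and> y \<in> Y closure_of A"
  have "h ` topspace X = topspace Y"
    using h homeomorphic_imp_surjective_map by blast
  then obtain A0 where A0: "A0 \<subseteq> topspace X" "A = h ` A0"
    using * by (metis subset_image_iff)
  then obtain x where x: "x \<in> X closure_of A0" "y = h x"
    using * homeomorphic_map_closure_of[OF h A0(1)] by auto
  then obtain B where B: "B \<subseteq> A0" "countable B" "x \<in> X closure_of B"
    using countably_tightD[OF X A0(1)] by blast
  then have "y \<in> Y closure_of (h ` B)"
    using homeomorphic_map_closure_of[OF h, of B] A0(1) x(2) by auto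
  then show "\<exists>B\<subseteq>A. countable B \<and> y \<in> Y closure_of B"
    using B A0(2) by (intro exI[of _ "h ` B"]) auto
qed

context locally_compact_perfectly_normal
begin

text \<open>
  Otherwise every countable subset of the closure of $A$ has compact closure, but countably many
  relatively compact open sets never cover it. A recursion of length $\omega_1$ then yields an
  uncountable set that is both left and right separated, hence discrete. One of its countably many
  closed discrete parts contains an infinite countable set, which is its own compact closure.
\<close>

lemma compactin_closure_of_if_countable:
  assumes AX: "A \<subseteq> topspace X"
    and A: "\<And>B. B \<subseteq> A \<Longrightarrow> countable B \<Longrightarrow> compactin X (X closure_of B)"
  shows "compactin X (X closure_of A)"
proof (rule ccontr)
  assume nc: "\<not> compactin X (X closure_of A)"
  let ?F = "X closure_of A"
  have FX: "?F \<subseteq> topspace X"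
    by (rule closure_of_subset_topspace)
  \<comment> \<open>The assumption on countable subsets of \<open>A\<close> passes to countable
    subsets of its closure: by countable tightness each point of \<open>B\<close> is a limit of a
    countable part of \<open>A\<close>.\<close>
  have cpt: "compactin X (X closure_of B)" if B: "B \<subseteq> ?F" "countable B" for B
  proof -
    have "\<exists>E. E \<subseteq> A \<and> countable E \<and> b \<in> X closure_of E" if "b \<in> B" for b
      using countably_tightD[OF countably_tight AX] that B(1) by blast
    then obtain E where E: "\<And>b. b \<in> B \<Longrightarrow> E b \<subseteq> A \<and> countable (E b) \<and> b \<in> X closure_of (E b)"
      by metis
    let ?E = "\<Union>b\<in>B. E b"
    have "compactin X (X closure_of ?E)"
      using E B(2) by (intro A) auto
    moreover have "B \<subseteq> X closure_of ?E"
    proof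
      fix b assume b: "b \<in> B"
      then have "X closure_of (E b) \<subseteq> X closure_of ?E"
        by (intro closure_of_mono) blast
      then show "b \<in> X closure_of ?E"
        using E[OF b] by blast
    qed
    then have "X closure_of B \<subseteq> X closure_of ?E"
      by (simp add: closure_of_minimal)
    ultimately show ?thesis
      using closed_compactin closedin_closure_of by metis
  qed
  \<comment> \<open>If the sets did cover, choose \<open>b m\<close> outside the first
    \<open>m\<close> of them. The closure of \<open>range b\<close> is compact, so it lies in
    finitely many of them, say among the first \<open>m\<close>, which excludes \<open>b m\<close>.
    Inserting \<open>{}\<close> makes the enumerated family nonempty.\<close>
  have outside: "\<exists>x\<in>?F. x \<notin> \<Union>\<U>"
    if \<U>: "countable \<U>" "\<And>U. U \<in> \<U> \<Longrightarrow> openin X U \<and> compactin X (X closure_of U)" for \<U>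
  proof (rule ccontr)
    assume "\<not> (\<exists>x\<in>?F. x \<notin> \<Union>\<U>)"
    then have cov: "?F \<subseteq> \<Union>\<U>"
      by blast
    define U where "U = from_nat_into (insert {} \<U>)"
    have rangeU: "range U = insert {} \<U>"
      using \<U>(1) by (simp add: U_def range_from_nat_into)
    have U: "openin X (U n)" "compactin X (X closure_of (U n))" for n
    proof -
      have "U n \<in> insert {} \<U>"
        using rangeU by blast
      then show "openin X (U n)" "compactin X (X closure_of (U n))"
        using \<U>(2) by auto
    qed
    have "\<exists>b\<in>?F. b \<notin> (\<Union>k<m. U k)" for m
    proof (rule ccontr)
      assume "\<not> (\<exists>b\<in>?F. b \<notin> (\<Union>k<m. U k))"
      moreover have "U k \<subseteq> X closure_of (U k)" for k
        using U(1) by (simp add: closure_of_subset openin_subset)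
      ultimately have "?F \<subseteq> (\<Union>k<m. X closure_of (U k))"
        by blast
      moreover have "compactin X (\<Union>k<m. X closure_of (U k))"
        using U(2) by (intro compactin_Union) auto
      ultimately show False
        using nc closed_compactin closedin_closure_of by metis
    qed
    then obtain b where b: "\<And>m. b m \<in> ?F" "\<And>m. b m \<notin> (\<Union>k<m. U k)"
      by metis
    have "compactin X (X closure_of (range b))"
      using b(1) by (intro cpt) auto
    moreover have bF: "X closure_of (range b) \<subseteq> ?F"
      using b(1) by (intro closure_of_minimal) auto
    then have "X closure_of (range b) \<subseteq> (\<Union>n\<in>UNIV. U n)"
      using cov rangeU by auto
    ultimately obtain I where I: "finite I" "X closure_of (range b) \<subseteq> (\<Union>n\<in>I. U n)"
      using compactin_indexed_subcover[of X _ UNIV U] U(1) by metis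
    obtain m where m: "I \<subseteq> {..<m}"
      using I(1) finite_nat_iff_bounded by blast
    have "range b \<subseteq> X closure_of (range b)"
      using b(1) FX by (intro closure_of_subset) auto
    then have "b m \<in> (\<Union>n\<in>I. U n)"
      using I(2) by blast
    then show False
      using b(2)[of m] m by blast
  qed
  \<comment> \<open>Each stage picks a point together with an open set that contains it and the
    closure of the earlier points, while the point avoids that closure and all earlier open sets.
    Then \<open>U i\<close> minus the closure of the earlier points isolates \<open>x i\<close>:
    later points miss \<open>U i\<close>, earlier ones are removed.\<close>
  define P where "P f i p \<longleftrightarrow> fst p \<in> ?F \<and> openin X (snd p) \<and> compactin X (X closure_of (snd p)) \<and>
      fst p \<in> snd p \<and> X closure_of (fst ` f ` {..<i}) \<subseteq> snd p \<and>
      fst p \<notin> X closure_of (fst ` f ` {..<i}) \<and> (\<forall>j<i. fst p \<notin> snd (f j))"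
    for f :: "omega1 \<Rightarrow> 'a \<times> 'a set" and i p
  have "\<exists>f. \<forall>i. P f i (f i)"
  proof (rule dependent_wellorder_choice)
    fix r i and f g :: "omega1 \<Rightarrow> 'a \<times> 'a set"
    assume fg: "\<And>j. j < i \<Longrightarrow> f j = g j"
    then have "f ` {..<i} = g ` {..<i}"
      by (intro image_cong) auto
    then show "P f i r = P g i r"
      using fg by (simp add: P_def)
  next
    fix i and f :: "omega1 \<Rightarrow> 'a \<times> 'a set"
    assume f: "\<And>j. j < i \<Longrightarrow> P f j (f j)"
    have cnt: "countable (f ` {..<i})"
      by (simp add: countable_lessThan_omega1)
    have "fst ` f ` {..<i} \<subseteq> ?F"
      using f by (auto simp: P_def)
    then have "compactin X (X closure_of (fst ` f ` {..<i}))"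
      using cnt by (intro cpt) auto
    then obtain W where W: "openin X W" "X closure_of (fst ` f ` {..<i}) \<subseteq> W"
        "compactin X (X closure_of W)"
      using compactin_open_superset by metis
    have "\<exists>x\<in>?F. x \<notin> \<Union>(insert W (snd ` f ` {..<i}))"
    proof (rule outside)
      fix U assume "U \<in> insert W (snd ` f ` {..<i})"
      then show "openin X U \<and> compactin X (X closure_of U)"
        using W f by (auto simp: P_def)
    qed (use cnt in auto)
    then obtain x where x: "x \<in> ?F" "x \<notin> W" "\<And>j. j < i \<Longrightarrow> x \<notin> snd (f j)"
      by auto
    obtain V where V: "openin X V" "x \<in> V" "compactin X (X closure_of V)"
      using relatively_compact_neighbourhood x(1) FX by blast
    have "P f i (x, W \<union> V)"
      using x W V by (auto simp: P_def closure_of_Un compactin_Un)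
    then show "\<exists>p. P f i p"
      by blast
  qed
  then obtain f where f: "\<And>i. P f i (f i)"
    by blast
  define x where "x i = fst (f i)" for i
  define U where "U i = snd (f i)" for i
  have im: "fst ` f ` {..<i} = x ` {..<i}" for i
    by (auto simp: x_def image_image)
  have xF: "x i \<in> ?F" and opU: "openin X (U i)" and xU: "x i \<in> U i"
    and clU: "X closure_of (x ` {..<i}) \<subseteq> U i" and xcl: "x i \<notin> X closure_of (x ` {..<i})" for i
    using f[of i] unfolding P_def im by (auto simp: x_def U_def)
  have xU': "x i \<notin> U j" if "j < i" for i j
    using f[of i] that unfolding P_def by (auto simp: x_def U_def)
  have xX: "x i \<in> topspace X" for i
    using xF FX by blast
  have "inj x"
  proof (rule injI)
    fix i j assume "x i = x j"
    then show "i = j"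
      using xU[of i] xU[of j] xU'[of i j] xU'[of j i] by (cases i j rule: linorder_cases) auto
  qed
  have "discrete_subspace X (range x)"
    unfolding discrete_subspace_iff
  proof (intro conjI ballI)
    show "range x \<subseteq> topspace X"
      using xX by blast
    fix d assume "d \<in> range x"
    then obtain i where i: "d = x i"
      by blast
    have "x j = x i" if j: "x j \<in> U i - X closure_of (x ` {..<i})" for j
    proof (cases j i rule: linorder_cases)
      case less
      moreover have "x ` {..<i} \<subseteq> X closure_of (x ` {..<i})"
        using xX by (intro closure_of_subset) auto
      ultimately show ?thesis
        using j by blast
    next
      case greater
      then show ?thesis
        using j xU' by blast
    qed simp
    then have "(U i - X closure_of (x ` {..<i})) \<inter> range x = {d}"
      using xU xcl i by blast
    moreover have "openin X (U i - X closure_of (x ` {..<i}))"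
      using opU by (intro openin_diff) auto
    ultimately show "\<exists>U. openin X U \<and> U \<inter> range x = {d}"
      by blast
  qed
  then obtain G :: "nat \<Rightarrow> 'a set" where G: "\<And>n. closed_discrete X (G n)" "(\<Union>n. G n) = range x"
    using discrete_eq_UN_closed_discrete by metis
  have "\<exists>n. infinite (G n)"
  proof (rule ccontr)
    assume "\<nexists>n. infinite (G n)"
    then have "countable (\<Union>n. G n)"
      by (intro countable_UN) (auto intro: countable_finite)
    then have "countable (UNIV :: omega1 set)"
      unfolding G(2) using \<open>inj x\<close> by (rule countable_image_inj_on)
    then show False
      using uncountable_omega1 by blast
  qed
  then obtain n B where B: "B \<subseteq> G n" "countable B" "infinite B"
    by (meson infinite_countable_subset')
  have "closed_discrete X B"
    using G(1) B(1) closed_discrete_subset by blast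
  moreover have "B \<subseteq> range x"
    using B(1) G(2) by blast
  then have "B \<subseteq> ?F"
    using xF by blast
  then have "compactin X (X closure_of B)"
    using B(2) by (rule cpt)
  moreover have "X closure_of B = B"
    using calculation(1) by (simp add: closed_discrete_imp_closedin closure_of_closedin)
  ultimately show False
    using closed_discrete_compactin_imp_finite B(3) by metis
qed

text \<open>At a point of \<open>X\<close> tightness is inherited. If \<open>None\<close> is a limit
  of a set that omits it, the trace on \<open>X\<close> has noncompact closure, hence so has some
  countable part \<open>B\<close>; no closed compact set contains \<open>B\<close>, so
  \<open>B\<close> meets every neighbourhood of \<open>None\<close>.\<close>

lemma countably_tight_Alexandroff_compactification:
  "countably_tight (Alexandroff_compactification X)"
  unfolding countably_tight_def
proof (intro allI impI)
  let ?K = "Alexandroff_compactification X"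
  fix A p assume *: "A \<subseteq> topspace ?K \<and> p \<in> ?K closure_of A"
  define A' where "A' = {x. Some x \<in> A}"
  have A'X: "A' \<subseteq> topspace X"
    using * by (auto simp: A'_def)
  have lift: "\<exists>B\<subseteq>A. countable B \<and> p \<in> ?K closure_of B"
    if "B \<subseteq> A'" "countable B" "p \<in> ?K closure_of (Some ` B)" for B
    using that by (intro exI[of _ "Some ` B"]) (auto simp: A'_def)
  have meet: "\<exists>a\<in>A. a \<in> V" if "openin ?K V" "p \<in> V" for V
    using * that by (auto simp: in_closure_of)
  have pK: "p \<in> topspace ?K"
    using * by (simp add: in_closure_of)
  show "\<exists>B\<subseteq>A. countable B \<and> p \<in> ?K closure_of B"
  proof (cases p)
    case (Some x)
    have "x \<in> X closure_of A'"
      unfolding in_closure_of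
    proof (intro conjI allI impI)
      show "x \<in> topspace X"
        using pK Some by auto
      fix T assume "x \<in> T \<and> openin X T"
      then show "\<exists>y. y \<in> A' \<and> y \<in> T"
        using meet[of "Some ` T"] Some by (auto simp: A'_def)
    qed
    then obtain B where B: "B \<subseteq> A'" "countable B" "x \<in> X closure_of B"
      using countably_tightD[OF countably_tight A'X] by blast
    have "p \<in> ?K closure_of (Some ` B)"
      unfolding in_closure_of
    proof (intro conjI allI impI)
      fix V assume V: "p \<in> V \<and> openin ?K V"
      then have "openin X {z \<in> topspace X. Some z \<in> V}"
        using continuous_map_Some openin_continuous_map_preimage by blast
      moreover have "x \<in> {z \<in> topspace X. Some z \<in> V}"
        using V Some pK by auto
      ultimately obtain y where "y \<in> B" "y \<in> {z \<in> topspace X. Some z \<in> V}"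
        using B(3) unfolding in_closure_of by meson
      then show "\<exists>y. y \<in> Some ` B \<and> y \<in> V"
        by auto
    qed (rule pK)
    then show ?thesis
      using lift B by blast
  next
    case None
    show ?thesis
    proof (cases "None \<in> A")
      case True
      have "p \<in> ?K closure_of {None}"
        using closure_of_subset[of "{None}" ?K] None by auto
      then show ?thesis
        using True by (intro exI[of _ "{None}"]) auto
    next
      case False
      have "\<not> compactin X (X closure_of A')"
      proof
        assume "compactin X (X closure_of A')"
        then have "openin ?K (insert None (Some ` (topspace X - X closure_of A')))"
          unfolding openin_Alexandroff_compactification using closedin_closure_of by blast
        then obtain a where a: "a \<in> A" "a \<in> insert None (Some ` (topspace X - X closure_of A'))"
          using meet None by blast
        then obtain y where "a = Some y" "y \<notin> X closure_of A'"
          using False by blast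
        then show False
          using a(1) closure_of_subset[OF A'X] by (auto simp: A'_def)
      qed
      then obtain B where B: "B \<subseteq> A'" "countable B" "\<not> compactin X (X closure_of B)"
        using compactin_closure_of_if_countable[OF A'X] by blast
      have "p \<in> ?K closure_of (Some ` B)"
        unfolding in_closure_of
      proof (intro conjI allI impI)
        fix V assume "p \<in> V \<and> openin ?K V"
        then obtain C where C: "compactin X C" "closedin X C"
            "V = insert None (Some ` (topspace X - C))"
          using None unfolding openin_Alexandroff_compactification by blast
        have "\<not> B \<subseteq> C"
          using C(1,2) B(3) closed_compactin closedin_closure_of closure_of_minimal by metis
        then show "\<exists>y. y \<in> Some ` B \<and> y \<in> V"
          using C(3) B(1) A'X by blast
      qed (rule pK)
      then show ?thesis
        using lift B by blast
    qed
  qed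
qed

text \<open>
  The hypothesis speaks of topologies on \<open>'a\<close> only, so the compactification on \<open>'a option\<close> is
  transported along an injection \<open>'a option \<Rightarrow> 'a\<close>.
\<close>

lemma locally_countable_eq_UN_closed_discrete:
  assumes sigma_discrete: "\<And>(K :: 'a topology) Z. compact_space K \<Longrightarrow> Hausdorff_space K \<Longrightarrow>
      countably_tight K \<Longrightarrow> Z \<subseteq> topspace K \<Longrightarrow> locally_countable_space (subtopology K Z) \<Longrightarrow>
      has_card_aleph1 Z \<Longrightarrow> sigma_discrete_subspace K Z"
    and YX: "Y \<subseteq> topspace X"
    and loc: "\<And>y. y \<in> Y \<Longrightarrow> \<exists>U. openin X U \<and> y \<in> U \<and> countable (U \<inter> Y)"
    and small: "Y \<lesssim> (UNIV :: omega1 set)"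
  obtains F :: "nat \<Rightarrow> 'a set" where "\<And>n. closed_discrete X (F n)" "(\<Union>n. F n) = Y"
proof (cases "countable Y")
  case True
  \<comment> \<open>The hypothesis is about size exactly aleph_1, so a countable \<open>Y\<close> is
    split into points directly. Intersecting with \<open>Y\<close> covers the case that
    \<open>Y\<close> is empty.\<close>
  have "closed_discrete X (Y \<inter> {from_nat_into Y n})" for n
  proof -
    have "S = {} \<or> (\<exists>y\<in>Y. S = {y})" if "S \<subseteq> Y \<inter> {from_nat_into Y n}" for S
      using that by blast
    then show ?thesis
      using YX closedin_singleton unfolding closed_discrete_def by (metis closedin_empty subsetD)
  qed
  moreover have "(\<Union>n. Y \<inter> {from_nat_into Y n}) = Y"
    using True by (auto dest: from_nat_into_surj)
  ultimately show thesis
    by (rule that)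
next
  case False
  then have "infinite Y"
    using countable_finite by blast
  then have "infinite (UNIV :: 'a set)"
    using finite_subset[OF subset_UNIV] by metis
  then obtain h :: "'a option \<Rightarrow> 'a" where h: "inj h"
    by (rule inj_option_if_infinite)
  let ?K0 = "Alexandroff_compactification X"
  define K where "K = pullback_topology (range h) (inv h) ?K0"
  have "homeomorphic_maps ?K0 K h (inv h)"
    unfolding homeomorphic_maps_def
  proof (intro conjI ballI)
    have "inv h \<circ> h = id"
      using h by simp
    then show "continuous_map ?K0 K h"
      unfolding K_def by (intro continuous_map_pullback') auto
    show "continuous_map K ?K0 (inv h)"
      unfolding K_def using continuous_map_pullback[OF continuous_map_id, of "range h" "inv h" ?K0]
      by simp
    show "inv h (h x) = x" if "x \<in> topspace ?K0" for x
      using h by simp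
    show "h (inv h y) = y" if "y \<in> topspace K" for y
      using that by (auto simp: K_def topspace_pullback_topology f_inv_into_f)
  qed
  then have hom: "homeomorphic_map ?K0 K h"
    using homeomorphic_maps_map by blast
  then have "?K0 homeomorphic_space K"
    using homeomorphic_map_imp_homeomorphic_space by blast
  then have K: "compact_space K" "Hausdorff_space K"
    using homeomorphic_compact_space homeomorphic_Hausdorff_space
      compact_space_Alexandroff_compactification
      Hausdorff_space_Alexandroff_compactification[of X] Hausdorff locally_compact by metis+
  have tight: "countably_tight K"
    using homeomorphic_map_countably_tight[OF hom countably_tight_Alexandroff_compactification] .
  define e where "e = h \<circ> Some"
  have "inj e"
    using h by (simp add: e_def inj_compose)
  have e_open: "openin K (e ` U)" if "openin X U" for U
  proof -
    have "e ` U = h ` Some ` U"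
      by (auto simp: e_def)
    then show ?thesis
      using that homeomorphic_imp_open_map[OF hom] open_map_Some[of X] by (simp add: open_map_def)
  qed
  have "continuous_map X K e"
    unfolding e_def using continuous_map_Some homeomorphic_imp_continuous_map[OF hom]
    by (rule continuous_map_compose)
  then have e_pre: "openin X {x \<in> topspace X. e x \<in> V}" if "openin K V" for V
    using that openin_continuous_map_preimage by blast
  have "sigma_discrete_subspace K (e ` Y)"
  proof (rule sigma_discrete[OF K tight])
    show "e ` Y \<subseteq> topspace K"
      using YX e_open[OF openin_topspace] openin_subset by blast
    show "locally_countable_space (subtopology K (e ` Y))"
      unfolding locally_countable_space_def
    proof
      fix z assume "z \<in> topspace (subtopology K (e ` Y))"
      then obtain y where y: "y \<in> Y" "z = e y"
        by auto
      then obtain U where U: "openin X U" "y \<in> U" "countable (U \<inter> Y)"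
        using loc by blast
      have "e ` U \<inter> e ` Y = e ` (U \<inter> Y)"
        using \<open>inj e\<close> by (simp add: image_Int)
      moreover have "openin (subtopology K (e ` Y)) (e ` U \<inter> e ` Y)"
        using e_open[OF U(1)] by (auto simp: openin_subtopology)
      ultimately show "\<exists>U. openin (subtopology K (e ` Y)) U \<and> z \<in> U \<and> countable U"
        using y U(2,3) by (intro exI[of _ "e ` (U \<inter> Y)"]) auto
    qed
    show "has_card_aleph1 (e ` Y)"
    proof (rule has_card_aleph1I)
      show "uncountable (e ` Y)"
        using False \<open>inj e\<close> countable_image_inj_on inj_on_subset by blast
      show "e ` Y \<lesssim> (UNIV :: omega1 set)"
        using image_lepoll small by (rule lepoll_trans)
    qed
  qed
  then obtain F :: "nat \<Rightarrow> 'a set" where F: "\<And>n. discrete_subspace K (F n)" "e ` Y = (\<Union>n. F n)"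
    unfolding sigma_discrete_subspace_def by blast
  define G where "G n = {y \<in> Y. e y \<in> F n}" for n
  have "discrete_subspace X (G n)" for n
    unfolding discrete_subspace_iff
  proof (intro conjI ballI)
    show "G n \<subseteq> topspace X"
      using YX by (auto simp: G_def)
    fix d assume d: "d \<in> G n"
    then have "e d \<in> F n"
      by (simp add: G_def)
    then obtain V where V: "openin K V" "V \<inter> F n = {e d}"
      using F(1)[of n] by (auto simp: discrete_subspace_iff)
    have "{x \<in> topspace X. e x \<in> V} \<inter> G n = {d}"
    proof
      show "{x \<in> topspace X. e x \<in> V} \<inter> G n \<subseteq> {d}"
      proof
        fix x assume "x \<in> {x \<in> topspace X. e x \<in> V} \<inter> G n"
        then have "e x \<in> V \<inter> F n"
          by (auto simp: G_def)
        then have "e x = e d"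
          using V(2) by simp
        then show "x \<in> {d}"
          using \<open>inj e\<close> by (simp add: inj_eq)
      qed
      show "{d} \<subseteq> {x \<in> topspace X. e x \<in> V} \<inter> G n"
        using d V(2) YX by (auto simp: G_def)
    qed
    then show "\<exists>U. openin X U \<and> U \<inter> G n = {d}"
      using e_pre[OF V(1)] by blast
  qed
  \<comment> \<open>The hypothesis gives sets that are merely discrete; the F-sigma property of open
    sets splits each one further into closed discrete sets.\<close>
  then have "\<exists>H :: nat \<Rightarrow> 'a set. (\<forall>m. closed_discrete X (H m)) \<and> (\<Union>m. H m) = G n" for n
    using discrete_eq_UN_closed_discrete[of "G n"] by metis
  then obtain H :: "nat \<Rightarrow> nat \<Rightarrow> 'a set"
    where H: "\<And>n m. closed_discrete X (H n m)" "\<And>n. (\<Union>m. H n m) = G n"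
    by metis
  show thesis
  proof (rule that[of "\<lambda>k. case prod_decode k of (n, m) \<Rightarrow> H n m"])
    show "closed_discrete X (case prod_decode k of (n, m) \<Rightarrow> H n m)" for k
      using H(1) by (simp split: prod.split)
    have "(\<Union>k. case prod_decode k of (n, m) \<Rightarrow> H n m) = (\<Union>p\<in>range prod_decode. case p of (n, m) \<Rightarrow> H n m)"
      by (simp only: image_image)
    also have "\<dots> = (\<Union>n. \<Union>m. H n m)"
      unfolding surj_prod_decode by auto
    also have "\<dots> = (\<Union>n. G n)"
      by (simp add: H(2))
    also have "\<dots> = Y"
    proof
      show "Y \<subseteq> (\<Union>n. G n)"
      proof
        fix y assume "y \<in> Y"
        moreover from this have "e y \<in> (\<Union>n. F n)"
          unfolding F(2)[symmetric] by (rule imageI)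
        ultimately show "y \<in> (\<Union>n. G n)"
          by (auto simp: G_def)
      qed
    qed (auto simp: G_def)
    finally show "(\<Union>k. case prod_decode k of (n, m) \<Rightarrow> H n m) = Y" .
  qed
qed

end

section \<open>Star-countable covers\<close>

lemma component_closedin:
  assumes op: "\<And>J. J \<in> \<Union>\<C> \<Longrightarrow> openin X J" and cover: "\<Union>(\<Union>\<C>) = topspace X"
    and disj: "\<And>\<A> \<B>. \<A> \<in> \<C> \<Longrightarrow> \<B> \<in> \<C> \<Longrightarrow> \<A> \<noteq> \<B> \<Longrightarrow> \<Union>\<A> \<inter> \<Union>\<B> = {}"
    and \<A>: "\<A> \<in> \<C>"
  shows "closedin X (\<Union>\<A>)"
proof -
  have "topspace X - \<Union>\<A> = \<Union>(\<Union>(\<C> - {\<A>}))"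
  proof
    show "topspace X - \<Union>\<A> \<subseteq> \<Union>(\<Union>(\<C> - {\<A>}))"
      unfolding cover[symmetric] by blast
    show "\<Union>(\<Union>(\<C> - {\<A>})) \<subseteq> topspace X - \<Union>\<A>"
    proof
      fix x assume "x \<in> \<Union>(\<Union>(\<C> - {\<A>}))"
      then obtain \<B> where \<B>: "\<B> \<in> \<C>" "\<B> \<noteq> \<A>" "x \<in> \<Union>\<B>"
        by blast
      then have "x \<in> topspace X"
        unfolding cover[symmetric] by blast
      then show "x \<in> topspace X - \<Union>\<A>"
        using disj[OF \<B>(1) \<A> \<B>(2)] \<B>(3) by blast
    qed
  qed
  moreover have "openin X (\<Union>(\<Union>(\<C> - {\<A>})))"
    using op by (intro openin_Union) auto
  moreover have "\<Union>\<A> \<subseteq> topspace X"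
    unfolding cover[symmetric] using \<A> by blast
  ultimately show ?thesis
    by (simp add: closedin_def)
qed

section \<open>A cover whose stars have size at most aleph_1\<close>

context cwH_locally_compact_perfectly_normal
begin

text \<open>
  Well-order the points, choose relatively compact neighbourhoods \<open>N x\<close> and let \<open>V x\<close> be the part
  of \<open>N x\<close> not covered by earlier ones. Every compact set meets only countably many \<open>V x\<close>, so a greedy
  colouring with $\omega_1$ colours ensures that \<open>N x\<close> misses \<open>V y\<close> for all other \<open>y\<close> of the colour
  of \<open>x\<close>. Hence a selection from the \<open>V x\<close> is a union of $\aleph_1$ closed discrete sets and can be
  expanded. Repeatedly expanding selections of points not yet covered exhausts each \<open>V x\<close> before
  stage $\omega_1$, since \<open>V x\<close> lies in a hereditarily Lindelof compact set.
\<close>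

lemma small_star_open_cover:
  obtains \<J> where "\<And>J. J \<in> \<J> \<Longrightarrow> openin X J" "\<And>J. J \<in> \<J> \<Longrightarrow> compactin X (X closure_of J)"
    "\<Union>\<J> = topspace X" "\<And>K. compactin X K \<Longrightarrow> {J \<in> \<J>. J \<inter> K \<noteq> {}} \<lesssim> (UNIV :: omega1 set)"
proof -
  have "\<forall>x. \<exists>N. x \<in> topspace X \<longrightarrow> openin X N \<and> x \<in> N \<and> compactin X (X closure_of N)"
    using relatively_compact_neighbourhood by metis
  then obtain N where N: "\<And>x. x \<in> topspace X \<Longrightarrow> openin X (N x)"
    "\<And>x. x \<in> topspace X \<Longrightarrow> x \<in> N x" "\<And>x. x \<in> topspace X \<Longrightarrow> compactin X (X closure_of (N x))"
    by metis
  have N_cl: "N x \<subseteq> X closure_of (N x)" if "x \<in> topspace X" for x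
    using N(1)[OF that] by (simp add: closure_of_subset openin_subset)
  obtain r where r: "well_order_on (UNIV :: 'a set) r"
    using well_order_on by blast
  define R where "R = r - Id"
  have wfR: "wf R" and totR: "\<And>x y. x \<noteq> y \<Longrightarrow> (x, y) \<in> R \<or> (y, x) \<in> R"
    using r by (auto simp: R_def order_on_defs total_on_def)
  define V where "V x = N x - (\<Union>y\<in>{y \<in> topspace X. (y, x) \<in> R}. N y)" for x
  have V_cover: "\<exists>x\<in>topspace X. y \<in> V x" if "y \<in> topspace X" for y
  proof -
    define Q where "Q = {x \<in> topspace X. y \<in> N x}"
    have "y \<in> Q"
      using that N(2) by (simp add: Q_def)
    then have "\<exists>x\<in>Q. \<forall>z. (z, x) \<in> R \<longrightarrow> z \<notin> Q"
      using wfR unfolding wf_eq_minimal by blast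
    then obtain x where x: "x \<in> {x \<in> topspace X. y \<in> N x}"
        "\<And>z. (z, x) \<in> R \<Longrightarrow> z \<notin> {x \<in> topspace X. y \<in> N x}"
      unfolding Q_def by blast
    then have "y \<in> V x"
      unfolding V_def by blast
    then show ?thesis
      using x(1) by blast
  qed
  have V_disj: "V x \<inter> V y = {}" if "x \<in> topspace X" "y \<in> topspace X" "x \<noteq> y" for x y
    using that totR[OF that(3)] unfolding V_def by blast
  have V_countable: "countable {x \<in> topspace X. K \<inter> V x \<noteq> {}}" if "compactin X K" for K
    unfolding V_def using that N(1) wfR totR by (rule countable_new_points)
  \<comment> \<open>Only earlier \<open>y\<close> have to be avoided: for later \<open>y\<close> the
    set \<open>V y\<close> misses \<open>N x\<close> by construction. The closure of
    \<open>N x\<close> is compact and meets countably many \<open>V y\<close>, so a colour below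
    omega_1 is free.\<close>
  define col where "col c x k \<longleftrightarrow>
      (\<forall>y. (y, x) \<in> R \<longrightarrow> x \<in> topspace X \<and> y \<in> topspace X \<and> N x \<inter> V y \<noteq> {} \<longrightarrow> c y \<noteq> k)"
    for c :: "'a \<Rightarrow> omega1" and x k
  have "\<exists>c. \<forall>x. col c x (c x)"
  proof (rule dependent_wf_choice[OF wfR])
    fix c c' :: "'a \<Rightarrow> omega1" and x k
    assume "\<And>y. (y, x) \<in> R \<Longrightarrow> c y = c' y"
    then show "col c x k = col c' x k"
      by (auto simp: col_def)
  next
    fix x and c :: "'a \<Rightarrow> omega1"
    show "\<exists>k. col c x k"
    proof (cases "x \<in> topspace X")
      case True
      let ?S = "{y \<in> topspace X. X closure_of (N x) \<inter> V y \<noteq> {}}"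
      have "countable (c ` ?S)"
        using V_countable[OF N(3)[OF True]] by blast
      then obtain k where "c ` ?S \<subseteq> {..<k}"
        by (rule countable_bounded_omega1)
      then have k: "k \<notin> c ` ?S"
        by blast
      have "col c x k"
        unfolding col_def
      proof (intro allI impI)
        fix y assume "x \<in> topspace X \<and> y \<in> topspace X \<and> N x \<inter> V y \<noteq> {}"
        then have "y \<in> ?S"
          using N_cl[OF True] by blast
        then show "c y \<noteq> k"
          using k by blast
      qed
      then show ?thesis
        by blast
    qed (simp add: col_def)
  qed
  then obtain c :: "'a \<Rightarrow> omega1" where c: "\<And>x. col c x (c x)"
    by blast
  have selection: "\<exists>J. (\<forall>x\<in>A. openin X (J x) \<and> d x \<in> J x) \<and>
      (\<forall>K. compactin X K \<longrightarrow> {x \<in> A. J x \<inter> K \<noteq> {}} \<lesssim> (UNIV :: omega1 set))"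
    if A: "A \<subseteq> topspace X" and d: "\<And>x. x \<in> A \<Longrightarrow> d x \<in> V x" for A and d :: "'a \<Rightarrow> 'a"
  proof -
    have inj: "inj_on d A"
    proof (rule inj_onI)
      fix x y assume "x \<in> A" "y \<in> A" "d x = d y"
      then have "V x \<inter> V y \<noteq> {}" "x \<in> topspace X" "y \<in> topspace X"
        using d[of x] d[of y] A by auto
      then show "x = y"
        using V_disj by blast
    qed
    have dN: "d x \<in> N x" if "x \<in> A" for x
      using d[OF that] by (simp add: V_def)
    have disc: "discrete_subspace X (d ` {x \<in> A. c x = k})" for k
      unfolding discrete_subspace_iff
    proof (intro conjI ballI)
      show "d ` {x \<in> A. c x = k} \<subseteq> topspace X"
        using dN A N(1) openin_subset by blast
      fix z assume "z \<in> d ` {x \<in> A. c x = k}"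
      then obtain x where x: "x \<in> A" "c x = k" "z = d x"
        by blast
      have "x' = x" if x': "x' \<in> A" "c x' = k" "d x' \<in> N x" for x'
      proof (rule ccontr)
        assume "x' \<noteq> x"
        then consider "(x', x) \<in> R" | "(x, x') \<in> R"
          using totR by blast
        then show False
        proof cases
          case 1
          moreover have "N x \<inter> V x' \<noteq> {}"
            using d x' by blast
          ultimately show False
            using c[of x] x x' A unfolding col_def by blast
        next
          case 2
          then show False
            using d[OF x'(1)] x'(3) x(1) A unfolding V_def by blast
        qed
      qed
      then have "N x \<inter> d ` {x \<in> A. c x = k} = {z}"
        using x dN by auto
      then show "\<exists>U. openin X U \<and> U \<inter> d ` {x \<in> A. c x = k} = {z}"
        using N(1) A x(1) by blast
    qed
    have "\<exists>F :: nat \<Rightarrow> 'a set. (\<forall>n. closed_discrete X (F n)) \<and> (\<Union>n. F n) = d ` {x \<in> A. c x = k}" for k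
    proof (rule discrete_eq_UN_closed_discrete[OF disc[of k]])
      fix F :: "nat \<Rightarrow> 'a set"
      assume "\<And>n. closed_discrete X (F n)" "(\<Union>n. F n) = d ` {x \<in> A. c x = k}"
      then show ?thesis
        by blast
    qed
    then obtain F :: "omega1 \<Rightarrow> nat \<Rightarrow> 'a set"
      where F: "\<And>k n. closed_discrete X (F k n)" "\<And>k. (\<Union>n. F k n) = d ` {x \<in> A. c x = k}"
      by metis
    \<comment> \<open>One countable decomposition per colour, hence the indices
      \<open>omega1 \<times> nat\<close>: a compact set meets finitely many members per index, so at
      most aleph_1 in all.\<close>
    define F' where "F' = (\<lambda>(k, n). F k n)"
    have "closed_discrete X (F' p)" for p
      using F(1) by (simp add: F'_def split: prod.split)
    from UN_closed_discrete_expansion[of F', OF this]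
    obtain J where J: "\<forall>z\<in>\<Union>p. F' p. openin X (J z) \<and> z \<in> J z"
      "\<forall>K. compactin X K \<longrightarrow>
         (\<exists>T. (\<forall>p :: omega1 \<times> nat. finite (T p)) \<and> {z \<in> (\<Union>p. F' p). J z \<inter> K \<noteq> {}} \<subseteq> (\<Union>p. T p))"
      by (elim exE conjE)
    have "(\<Union>p. F' p) = (\<Union>k. \<Union>n. F k n)"
      by (auto simp: F'_def)
    also have "\<dots> = d ` A"
      by (auto simp: F(2))
    finally have F': "(\<Union>p. F' p) = d ` A" .
    have "{x \<in> A. J (d x) \<inter> K \<noteq> {}} \<lesssim> (UNIV :: omega1 set)" if K: "compactin X K" for K
    proof -
      obtain T where T: "\<forall>p :: omega1 \<times> nat. finite (T p)" "{z \<in> d ` A. J z \<inter> K \<noteq> {}} \<subseteq> (\<Union>p. T p)"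
        using J(2)[rule_format, OF K] unfolding F' by (elim exE conjE)
      have "(\<Union>n. T (k, n)) \<lesssim> (UNIV :: omega1 set)" for k
        using T(1) by (intro countable_imp_lepoll_infinite[OF infinite_omega1] countable_UN)
          (auto intro: countable_finite)
      then have "(\<Union>k. \<Union>n. T (k, n)) \<lesssim> (UNIV :: omega1 set)"
        by - (rule UN_lepoll_infinite[OF infinite_omega1 lepoll_refl])
      moreover have "(\<Union>p. T p) = (\<Union>k. \<Union>n. T (k, n))"
        by auto
      ultimately have small: "(\<Union>p. T p) \<lesssim> (UNIV :: omega1 set)"
        by simp
      have "inj_on d {x \<in> A. J (d x) \<inter> K \<noteq> {}}"
        using inj by (rule inj_on_subset) blast
      moreover have "d ` {x \<in> A. J (d x) \<inter> K \<noteq> {}} \<subseteq> (\<Union>p. T p)"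
        using T(2) by blast
      ultimately have "{x \<in> A. J (d x) \<inter> K \<noteq> {}} \<lesssim> (\<Union>p. T p)"
        unfolding lepoll_def by blast
      then show ?thesis
        using small by (rule lepoll_trans)
    qed
    moreover have "\<forall>x\<in>A. openin X (J (d x)) \<and> d x \<in> J (d x)"
      using J(1) unfolding F' by blast
    ultimately show ?thesis
      by (intro exI[of _ "\<lambda>x. J (d x)"]) simp
  qed
  define P where "P f i J \<longleftrightarrow>
      (\<forall>x\<in>topspace X. openin X (J x) \<and> compactin X (X closure_of (J x))) \<and>
      (\<forall>K. compactin X K \<longrightarrow> {x \<in> topspace X. J x \<inter> K \<noteq> {}} \<lesssim> (UNIV :: omega1 set)) \<and>
      (\<forall>x\<in>topspace X. V x \<subseteq> (\<Union>j\<in>{..<i}. f j x) \<or> (\<exists>y\<in>V x. y \<in> J x \<and> y \<notin> (\<Union>j\<in>{..<i}. f j x)))"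
    for f :: "omega1 \<Rightarrow> 'a \<Rightarrow> 'a set" and i J
  have "\<exists>f. \<forall>i. P f i (f i)"
  proof (rule dependent_wellorder_choice)
    fix J i and f g :: "omega1 \<Rightarrow> 'a \<Rightarrow> 'a set"
    assume "\<And>j. j < i \<Longrightarrow> f j = g j"
    then have "(\<Union>j\<in>{..<i}. f j x) = (\<Union>j\<in>{..<i}. g j x)" for x
      by auto
    then show "P f i J = P g i J"
      by (simp add: P_def)
  next
    fix i and f :: "omega1 \<Rightarrow> 'a \<Rightarrow> 'a set"
    define A where "A = {x \<in> topspace X. \<not> V x \<subseteq> (\<Union>j\<in>{..<i}. f j x)}"
    have "\<exists>y. y \<in> V x \<and> y \<notin> (\<Union>j\<in>{..<i}. f j x)" if "x \<in> A" for x
      using that by (auto simp: A_def)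
    then obtain d where d: "\<And>x. x \<in> A \<Longrightarrow> d x \<in> V x" "\<And>x. x \<in> A \<Longrightarrow> d x \<notin> (\<Union>j\<in>{..<i}. f j x)"
      by metis
    have AX: "A \<subseteq> topspace X"
      by (auto simp: A_def)
    obtain J where J: "\<And>x. x \<in> A \<Longrightarrow> openin X (J x)" "\<And>x. x \<in> A \<Longrightarrow> d x \<in> J x"
      "\<And>K. compactin X K \<Longrightarrow> {x \<in> A. J x \<inter> K \<noteq> {}} \<lesssim> (UNIV :: omega1 set)"
      using selection[OF AX d(1)] by blast
    \<comment> \<open>Intersecting with \<open>N x\<close> makes the sets relatively compact and
      keeps \<open>d x\<close>, which lies in \<open>V x \<subseteq> N x\<close>. Once
      \<open>V x\<close> is exhausted, nothing more is added for \<open>x\<close>.\<close>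
    define J' where "J' x = (if x \<in> A then J x \<inter> N x else {})" for x
    have "P f i J'"
      unfolding P_def
    proof (intro conjI ballI allI impI)
      fix x assume x: "x \<in> topspace X"
      then show "openin X (J' x)"
        using J(1) N(1) by (auto simp: J'_def)
      have "X closure_of (J' x) \<subseteq> X closure_of (N x)"
        by (rule closure_of_mono) (auto simp: J'_def)
      then show "compactin X (X closure_of (J' x))"
        using N(3)[OF x] closed_compactin closedin_closure_of by metis
      show "V x \<subseteq> (\<Union>j\<in>{..<i}. f j x) \<or> (\<exists>y\<in>V x. y \<in> J' x \<and> y \<notin> (\<Union>j\<in>{..<i}. f j x))"
      proof (cases "x \<in> A")
        case True
        then have "d x \<in> J' x"
          using J(2) d(1) by (auto simp: J'_def V_def)
        then show ?thesis
          using d True by blast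
      next
        case False
        then show ?thesis
          using x by (simp add: A_def)
      qed
    next
      fix K assume K: "compactin X K"
      have "{x \<in> topspace X. J' x \<inter> K \<noteq> {}} \<subseteq> {x \<in> A. J x \<inter> K \<noteq> {}}"
        by (auto simp: J'_def split: if_splits)
      then show "{x \<in> topspace X. J' x \<inter> K \<noteq> {}} \<lesssim> (UNIV :: omega1 set)"
        using J(3)[OF K] by (rule subset_lepoll_trans)
    qed
    then show "\<exists>J. P f i J"
      by blast
  qed
  then obtain f where f: "\<And>i. P f i (f i)"
    by blast
  have f_open: "openin X (f i x)" and f_cpt: "compactin X (X closure_of (f i x))"
    if "x \<in> topspace X" for i x
    using f[of i] that by (simp_all add: P_def)
  have f_star: "{x \<in> topspace X. f i x \<inter> K \<noteq> {}} \<lesssim> (UNIV :: omega1 set)" if "compactin X K" for i K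
    using f[of i] that by (simp add: P_def)
  have f_new: "V x \<subseteq> (\<Union>j\<in>{..<i}. f j x) \<or> (\<exists>y\<in>V x. y \<in> f i x \<and> y \<notin> (\<Union>j\<in>{..<i}. f j x))"
    if "x \<in> topspace X" for i x
    using f[of i] that unfolding P_def by blast
  have V_sub: "V x \<subseteq> (\<Union>i. f i x)" if x: "x \<in> topspace X" for x
  proof -
    \<comment> \<open>The countable subcover is taken for the union of all stages, as
      \<open>V x\<close> is not yet known to be covered. Beyond the bound of \<open>B\<close> no
      stage can contribute a new point of \<open>V x\<close>.\<close>
    obtain B where B: "countable B" "X closure_of (N x) \<inter> (\<Union>i. f i x) \<subseteq> (\<Union>i\<in>B. f i x)"
      using compactin_countable_subcover[OF N(3)[OF x], of UNIV "\<lambda>i. f i x"] f_open[OF x] by metis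
    obtain i where i: "B \<subseteq> {..<i}"
      using B(1) by (rule countable_bounded_omega1)
    have "V x \<subseteq> (\<Union>j\<in>{..<i}. f j x)"
    proof (rule ccontr)
      assume "\<not> V x \<subseteq> (\<Union>j\<in>{..<i}. f j x)"
      then obtain y where y: "y \<in> V x" "y \<in> f i x" "y \<notin> (\<Union>j\<in>{..<i}. f j x)"
        using f_new[OF x, of i] by blast
      have "y \<in> X closure_of (N x)"
        using y(1) N_cl[OF x] by (auto simp: V_def)
      then have "y \<in> (\<Union>j\<in>B. f j x)"
        using B(2) y(2) by blast
      then show False
        using y(3) i by blast
    qed
    then show ?thesis
      by blast
  qed
  define \<J> where "\<J> = (\<Union>i. f i ` topspace X)"
  show thesis
  proof (rule that[of \<J>])
    show "openin X J" "compactin X (X closure_of J)" if "J \<in> \<J>" for J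
      using that f_open f_cpt by (auto simp: \<J>_def)
    show "\<Union>\<J> = topspace X"
    proof
      show "\<Union>\<J> \<subseteq> topspace X"
        using f_open openin_subset by (fastforce simp: \<J>_def)
      show "topspace X \<subseteq> \<Union>\<J>"
      proof
        fix y assume "y \<in> topspace X"
        then obtain x where "x \<in> topspace X" "y \<in> V x"
          using V_cover by blast
        then show "y \<in> \<Union>\<J>"
          using V_sub[of x] unfolding \<J>_def by blast
      qed
    qed
    fix K assume K: "compactin X K"
    have "f i ` {x \<in> topspace X. f i x \<inter> K \<noteq> {}} \<lesssim> (UNIV :: omega1 set)" for i
      using image_lepoll f_star[OF K] by (rule lepoll_trans)
    then have small: "(\<Union>i. f i ` {x \<in> topspace X. f i x \<inter> K \<noteq> {}}) \<lesssim> (UNIV :: omega1 set)"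
      by - (rule UN_lepoll_infinite[OF infinite_omega1 lepoll_refl])
    have "{J \<in> \<J>. J \<inter> K \<noteq> {}} \<subseteq> (\<Union>i. f i ` {x \<in> topspace X. f i x \<inter> K \<noteq> {}})"
      by (auto simp: \<J>_def)
    then show "{J \<in> \<J>. J \<inter> K \<noteq> {}} \<lesssim> (UNIV :: omega1 set)"
      using small by (rule subset_lepoll_trans)
  qed
qed

end

text \<open>The assumption is what hypothesis (a) yields through the compactification, restated
  inside \<open>X\<close>.\<close>

locale locally_countable_sigma_closed_discrete = cwH_locally_compact_perfectly_normal +
  assumes locally_countable_UN: "\<And>Y. Y \<subseteq> topspace X \<Longrightarrow>
      (\<And>y. y \<in> Y \<Longrightarrow> \<exists>U. openin X U \<and> y \<in> U \<and> countable (U \<inter> Y)) \<Longrightarrow>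
      Y \<lesssim> (UNIV :: omega1 set) \<Longrightarrow>
      \<exists>F :: nat \<Rightarrow> 'a set. (\<forall>n. closed_discrete X (F n)) \<and> (\<Union>n. F n) = Y"
begin

lemma star_countable_refinement:
  fixes U :: "omega1 \<Rightarrow> 'a set"
  assumes U: "\<And>i. openin X (U i)" "\<And>i. compactin X (X closure_of (U i))"
    and clo: "closedin X (\<Union>i. U i)"
  obtains L :: "omega1 \<Rightarrow> 'a set"
  where "\<And>i. openin X (L i)" "\<And>i. L i \<subseteq> U i" "(\<Union>i. L i) = (\<Union>i. U i)"
    "\<And>i. countable {j. L j \<inter> L i \<noteq> {}}"
proof -
  define W where "W l = (\<Union>i\<in>{..<l}. U i)" for l
  have W_mono: "W k \<subseteq> W l" if "k \<le> l" for k l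
    unfolding W_def by (rule UN_mono) (use that in auto)
  have UW: "U i \<subseteq> W l" if "i < l" for i l
    using that by (auto simp: W_def)
  have W_open: "openin X (W l)" for l
    using U(1) by (auto simp: W_def)
  define E where "E = {l. \<not> closedin X (W l)}"
  have "\<exists>x. x \<in> X closure_of (W l) \<and> x \<notin> W l" if "l \<in> E" for l
  proof (rule ccontr)
    assume "\<nexists>x. x \<in> X closure_of (W l) \<and> x \<notin> W l"
    then have "X closure_of (W l) = W l"
      using closure_of_subset[OF openin_subset[OF W_open]] by blast
    then show False
      using that closedin_closure_of[of X "W l"] by (simp add: E_def)
  qed
  then obtain x where x: "\<And>l. l \<in> E \<Longrightarrow> x l \<in> X closure_of (W l)" "\<And>l. l \<in> E \<Longrightarrow> x l \<notin> W l"
    by metis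
  have xP: "x l \<in> (\<Union>i. U i)" if "l \<in> E" for l
  proof -
    have "X closure_of (W l) \<subseteq> (\<Union>i. U i)"
      using clo by (intro closure_of_minimal) (auto simp: W_def)
    then show ?thesis
      using x(1)[OF that] by blast
  qed
  \<comment> \<open>For \<open>l > i\<close> the set \<open>U i\<close> is part of
    \<open>W l\<close>, which \<open>x l\<close> avoids. Since the union of all \<open>U i\<close>
    is closed, every \<open>x l\<close> lies in some \<open>U i\<close>, so this makes the set of
    these points locally countable.\<close>
  have fibre: "countable {l \<in> E. x l \<in> U i}" for i
  proof -
    have "{l \<in> E. x l \<in> U i} \<subseteq> {..i}"
    proof
      fix l assume l: "l \<in> {l \<in> E. x l \<in> U i}"
      then have "\<not> i < l"
        using x(2) UW by blast
      then show "l \<in> {..i}"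
        by simp
    qed
    then show ?thesis
      using countable_atMost_omega1 countable_subset by blast
  qed
  let ?Y = "x ` E"
  have "\<exists>F :: nat \<Rightarrow> 'a set. (\<forall>n. closed_discrete X (F n)) \<and> (\<Union>n. F n) = ?Y"
  proof (rule locally_countable_UN)
    show "?Y \<subseteq> topspace X"
      using xP closedin_subset[OF clo] by blast
    show "?Y \<lesssim> (UNIV :: omega1 set)"
      by (rule lepoll_trans[OF image_lepoll subset_imp_lepoll]) simp
    fix y assume "y \<in> ?Y"
    then obtain i where "y \<in> U i"
      using xP by blast
    moreover have "U i \<inter> ?Y = x ` {l \<in> E. x l \<in> U i}"
      by blast
    then have "countable (U i \<inter> ?Y)"
      using fibre by simp
    ultimately show "\<exists>U. openin X U \<and> y \<in> U \<and> countable (U \<inter> ?Y)"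
      using U(1) by blast
  qed
  then obtain F :: "nat \<Rightarrow> 'a set" where F: "\<And>n. closed_discrete X (F n)" "(\<Union>n. F n) = ?Y"
    by blast
  from UN_closed_discrete_expansion[of F, OF F(1)]
  obtain J where J: "\<forall>y\<in>?Y. openin X (J y) \<and> y \<in> J y"
    "\<forall>K. compactin X K \<longrightarrow>
       (\<exists>T. (\<forall>n :: nat. finite (T n)) \<and> {y \<in> ?Y. J y \<inter> K \<noteq> {}} \<subseteq> (\<Union>n. T n))"
    unfolding F(2) by (elim exE conjE)
  define T where "T i = {l \<in> E. J (x l) \<inter> U i \<noteq> {}}" for i
  have T_countable: "countable (T i)" for i
  proof -
    obtain S where S: "\<forall>n :: nat. finite (S n)" "{y \<in> ?Y. J y \<inter> X closure_of (U i) \<noteq> {}} \<subseteq> (\<Union>n. S n)"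
      using J(2)[rule_format, OF U(2)[of i]] by (elim exE conjE)
    have "countable (\<Union>n. S n)"
      using S(1) by (intro countable_UN) (auto intro: countable_finite)
    then have "countable ((\<Union>n. S n) \<inter> ?Y)"
      by blast
    \<comment> \<open>The choice \<open>x\<close> need not be injective; \<open>fibre\<close> shows
      that each point is chosen for only countably many \<open>l\<close>.\<close>
    moreover have "countable {l \<in> E. x l = y}" if y: "y \<in> (\<Union>n. S n) \<inter> ?Y" for y
    proof -
      obtain j where "y \<in> U j"
        using y xP by blast
      then have "{l \<in> E. x l = y} \<subseteq> {l \<in> E. x l \<in> U j}"
        by blast
      then show ?thesis
        using fibre countable_subset by blast
    qed
    ultimately have "countable (\<Union>y\<in>(\<Union>n. S n) \<inter> ?Y. {l \<in> E. x l = y})"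
      by (rule countable_UN)
    moreover have "T i \<subseteq> (\<Union>y\<in>(\<Union>n. S n) \<inter> ?Y. {l \<in> E. x l = y})"
    proof
      fix l assume l: "l \<in> T i"
      have "U i \<subseteq> X closure_of (U i)"
        using U(1) by (simp add: closure_of_subset openin_subset)
      then have "x l \<in> (\<Union>n. S n) \<inter> ?Y"
        using l S(2) unfolding T_def by blast
      then show "l \<in> (\<Union>y\<in>(\<Union>n. S n) \<inter> ?Y. {l \<in> E. x l = y})"
        using l by (auto simp: T_def)
    qed
    ultimately show ?thesis
      using countable_subset by blast
  qed
  \<comment> \<open>If \<open>l \<in> C \<inter> E\<close>, then \<open>J (x l)\<close> meets some \<open>U i\<close> with \<open>i < l\<close>, so \<open>l \<in> T i \<subseteq> {..<l}\<close>.\<close>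
  define C where "C = {l. \<forall>i<l. T i \<subseteq> {..<l}}"
  have W_closed: "closedin X (W l)" if l: "l \<in> C" for l
  proof (rule ccontr)
    assume "\<not> closedin X (W l)"
    then have E: "l \<in> E"
      by (simp add: E_def)
    then have "\<exists>y. y \<in> W l \<and> y \<in> J (x l)"
      using x(1)[OF E] J(1) E unfolding in_closure_of by blast
    then obtain i where "i < l" "J (x l) \<inter> U i \<noteq> {}"
      by (auto simp: W_def)
    then have "l \<in> {..<l}"
      using E l unfolding C_def T_def by blast
    then show False
      by simp
  qed
  have C_unbounded: "\<exists>l\<in>C. i < l" for i
  proof -
    \<comment> \<open>Reachability goes down to smaller ordinals and along \<open>T\<close>. From
      \<open>i\<close> it yields a countable set that is downward closed, hence
      \<open>{..<l}\<close> for some \<open>l\<close>, and closure under \<open>T\<close> puts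
      \<open>l\<close> into \<open>C\<close>.\<close>
    define R where "R = {(j, k). k < j \<or> k \<in> T j}"
    have "R `` {j} = {..<j} \<union> T j" for j
      by (auto simp: R_def)
    then have "R `` {j} \<lesssim> (UNIV :: nat set)" for j
      using countable_lessThan_omega1 T_countable by (simp add: countable_iff_lepoll_nat[symmetric])
    then have "countable (R\<^sup>* `` {i})"
      unfolding countable_iff_lepoll_nat by (rule rtrancl_Image_lepoll[rotated]) simp
    then obtain k where k: "R\<^sup>* `` {i} \<subseteq> {..<k}"
      by (rule countable_bounded_omega1)
    define l where "l = (LEAST l. l \<notin> R\<^sup>* `` {i})"
    have "k \<notin> R\<^sup>* `` {i}"
      using k by blast
    then have l: "l \<notin> R\<^sup>* `` {i}"
      unfolding l_def by (rule LeastI)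
    have below: "j \<in> R\<^sup>* `` {i} \<longleftrightarrow> j < l" for j
    proof
      assume j: "j \<in> R\<^sup>* `` {i}"
      show "j < l"
      proof (rule ccontr)
        assume "\<not> j < l"
        then have "l < j"
          using j l by (cases j l rule: linorder_cases) auto
        then have "(j, l) \<in> R"
          by (simp add: R_def)
        then show False
          using j l by (auto intro: rtrancl_into_rtrancl)
      qed
    next
      assume "j < l"
      then show "j \<in> R\<^sup>* `` {i}"
        unfolding l_def using not_less_Least by blast
    qed
    have "T j \<subseteq> {..<l}" if "j < l" for j
    proof
      fix m assume "m \<in> T j"
      then have "(j, m) \<in> R"
        by (simp add: R_def)
      then have "m \<in> R\<^sup>* `` {i}"
        using that below[of j] by (auto intro: rtrancl_into_rtrancl)
      then show "m \<in> {..<l}"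
        using below by simp
    qed
    then have "l \<in> C"
      by (simp add: C_def)
    moreover have "i < l"
      using below[of i] by simp
    ultimately show ?thesis
      by blast
  qed
  define M where "M i = (\<Union>l\<in>{l \<in> C. l \<le> i}. W l)" for i
  have M_closed: "closedin X (M i)" for i
  proof -
    \<comment> \<open>\<open>m\<close> is the supremum of the part of \<open>C\<close> up to
      \<open>i\<close>, which lies in \<open>C\<close> because \<open>C\<close> is closed under
      suprema. If that part is empty, \<open>m\<close> is the least element and both
      \<open>M i\<close> and \<open>W m\<close> are empty.\<close>
    define m where "m = (LEAST m. \<forall>l\<in>{l \<in> C. l \<le> i}. l \<le> m)"
    have m: "\<forall>l\<in>{l \<in> C. l \<le> i}. l \<le> m"
      unfolding m_def by (rule LeastI[of _ i]) simp
    have cofinal: "\<exists>l\<in>C. l \<le> i \<and> j < l \<and> l \<le> m" if "j < m" for j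
      using not_less_Least[OF that[unfolded m_def]] m by (auto simp: not_le)
    have "T j \<subseteq> {..<m}" if jm: "j < m" for j
    proof -
      obtain l where "l \<in> C" "j < l" "l \<le> m"
        using cofinal[OF jm] by blast
      then show ?thesis
        unfolding C_def by force
    qed
    then have "m \<in> C"
      by (simp add: C_def)
    moreover have "M i = W m"
    proof
      show "M i \<subseteq> W m"
        using m W_mono unfolding M_def by blast
      show "W m \<subseteq> M i"
      proof
        fix y assume "y \<in> W m"
        then obtain j where j: "j < m" "y \<in> U j"
          by (auto simp: W_def)
        then obtain l where "l \<in> C" "l \<le> i" "j < l"
          using cofinal by blast
        then show "y \<in> M i"
          using UW j(2) unfolding M_def by blast
      qed
    qed
    ultimately show ?thesis
      using W_closed by simp
  qed
  show thesis
  proof (rule that[of "\<lambda>i. U i - M i"])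
    show "openin X (U i - M i)" for i
      using U(1) M_closed by (rule openin_diff)
    show "U i - M i \<subseteq> U i" for i
      by blast
    show "(\<Union>i. U i - M i) = (\<Union>i. U i)"
    proof
      show "(\<Union>i. U i) \<subseteq> (\<Union>i. U i - M i)"
      proof
        fix y assume "y \<in> (\<Union>i. U i)"
        then obtain k where k: "y \<in> U k"
          by blast
        \<comment> \<open>\<open>M i\<close> uses only \<open>W l\<close> with
          \<open>l \<le> i\<close>, that is, only \<open>U j\<close> with \<open>j < i\<close>; at
          its first index \<open>y\<close> is therefore not cut off.\<close>
        define i where "i = (LEAST i. y \<in> U i)"
        have "y \<in> U i"
          unfolding i_def using k by (rule LeastI)
        moreover have "y \<notin> U j" if "j < i" for j
          using that unfolding i_def by (rule not_less_Least)
        then have "y \<notin> M i"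
          by (force simp: M_def W_def)
        ultimately show "y \<in> (\<Union>i. U i - M i)"
          by blast
      qed
    qed blast
    show "countable {j. (U j - M j) \<inter> (U i - M i) \<noteq> {}}" for i
    proof -
      \<comment> \<open>Every \<open>j \<ge> l\<close> has
        \<open>U i \<subseteq> W l \<subseteq> M j\<close>, so the cut set with index
        \<open>j\<close> misses \<open>U i\<close>.\<close>
      obtain l where l: "l \<in> C" "i < l"
        using C_unbounded by blast
      have "{j. (U j - M j) \<inter> (U i - M i) \<noteq> {}} \<subseteq> {..<l}"
      proof
        fix j assume j: "j \<in> {j. (U j - M j) \<inter> (U i - M i) \<noteq> {}}"
        show "j \<in> {..<l}"
        proof (rule ccontr)
          assume "j \<notin> {..<l}"
          then have "W l \<subseteq> M j"
            using l(1) by (auto simp: M_def)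
          then have "U i \<subseteq> M j"
            using UW[OF l(2)] by blast
          then show False
            using j by blast
        qed
      qed
      then show ?thesis
        using countable_lessThan_omega1 countable_subset by blast
    qed
  qed
qed

text \<open>Each chain component of the aleph_1-star cover is refined separately. The components
  have disjoint unions, so the stars of the refinements do not mix.\<close>

lemma star_countable_open_cover:
  obtains \<L> where "\<And>L. L \<in> \<L> \<Longrightarrow> openin X L" "\<And>L. L \<in> \<L> \<Longrightarrow> compactin X (X closure_of L)"
    "\<Union>\<L> = topspace X" "\<And>L. L \<in> \<L> \<Longrightarrow> countable {L' \<in> \<L>. L' \<inter> L \<noteq> {}}"
proof (rule small_star_open_cover)
  fix \<J>
  assume \<J>: "\<And>J. J \<in> \<J> \<Longrightarrow> openin X J" "\<And>J. J \<in> \<J> \<Longrightarrow> compactin X (X closure_of J)"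
    "\<Union>\<J> = topspace X" "\<And>K. compactin X K \<Longrightarrow> {J \<in> \<J>. J \<inter> K \<noteq> {}} \<lesssim> (UNIV :: omega1 set)"
  have star: "{J' \<in> \<J>. J' \<inter> J \<noteq> {}} \<lesssim> (UNIV :: omega1 set)" if J: "J \<in> \<J>" for J
  proof -
    have "J \<subseteq> X closure_of J"
      using \<J>(1)[OF J] by (simp add: closure_of_subset openin_subset)
    then have "{J' \<in> \<J>. J' \<inter> J \<noteq> {}} \<subseteq> {J' \<in> \<J>. J' \<inter> X closure_of J \<noteq> {}}"
      by blast
    then show ?thesis
      using \<J>(4)[OF \<J>(2)[OF J]] by (rule subset_lepoll_trans)
  qed
  obtain \<C> where \<C>: "\<Union>\<C> = \<J>" "\<And>\<A>. \<A> \<in> \<C> \<Longrightarrow> \<A> \<lesssim> (UNIV :: omega1 set)"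
    "\<And>\<A> \<B>. \<A> \<in> \<C> \<Longrightarrow> \<B> \<in> \<C> \<Longrightarrow> \<A> \<noteq> \<B> \<Longrightarrow> \<Union>\<A> \<inter> \<Union>\<B> = {}"
    using star_small_components[OF infinite_omega1 star] by metis
  define good where "good \<A> \<L> \<longleftrightarrow> (\<forall>L\<in>\<L>. openin X L \<and> compactin X (X closure_of L)) \<and> \<Union>\<L> = \<Union>\<A> \<and>
      (\<forall>L\<in>\<L>. countable {L' \<in> \<L>. L' \<inter> L \<noteq> {}})" for \<A> \<L>
  have "\<exists>\<L>. good \<A> \<L>" if \<A>: "\<A> \<in> \<C>" for \<A>
  proof (cases "\<A> = {}")
    case True
    then show ?thesis
      by (intro exI[of _ "{}"]) (simp add: good_def)
  next
    case False
    then obtain J0 where J0: "J0 \<in> \<A>"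
      by blast
    obtain g :: "omega1 \<Rightarrow> 'a set" where g: "\<A> \<subseteq> range g"
      using \<C>(2)[OF \<A>] unfolding lepoll_iff by blast
    \<comment> \<open>\<open>g\<close> only enumerates a superset of \<open>\<A>\<close>; foreign
      values are replaced by the fixed member \<open>J0\<close>.\<close>
    define U where "U i = (if g i \<in> \<A> then g i else J0)" for i
    have "U i \<in> \<A>" for i
      using J0 by (simp add: U_def)
    moreover have "\<A> \<subseteq> range U"
    proof
      fix J assume "J \<in> \<A>"
      moreover from this obtain i where "J = g i"
        using g by blast
      ultimately have "J = U i"
        by (simp add: U_def)
      then show "J \<in> range U"
        by blast
    qed
    ultimately have rU: "range U = \<A>"
      by blast
    have U\<J>: "U i \<in> \<J>" for i
      using rU \<A> \<C>(1) by blast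
    have "closedin X (\<Union>i. U i)"
      unfolding rU using \<J>(1,3) \<C>(1,3) \<A> by (intro component_closedin[of \<C>]) auto
    then obtain L where L: "\<And>i. openin X (L i)" "\<And>i. L i \<subseteq> U i" "(\<Union>i. L i) = (\<Union>i. U i)"
      "\<And>i. countable {j. L j \<inter> L i \<noteq> {}}"
      using star_countable_refinement[of U] \<J>(1)[OF U\<J>] \<J>(2)[OF U\<J>] by metis
    have "compactin X (X closure_of (L i))" for i
      using \<J>(2)[OF U\<J>] closure_of_mono[OF L(2)] closed_compactin closedin_closure_of by metis
    moreover have "countable {L' \<in> range L. L' \<inter> L i \<noteq> {}}" for i
    proof -
      have "{L' \<in> range L. L' \<inter> L i \<noteq> {}} = L ` {j. L j \<inter> L i \<noteq> {}}"
        by blast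
      then show ?thesis
        using L(4) by simp
    qed
    ultimately have "good \<A> (range L)"
      using L(1,3) rU by (auto simp: good_def)
    then show ?thesis
      by blast
  qed
  then obtain \<L> where \<L>: "\<And>\<A>. \<A> \<in> \<C> \<Longrightarrow> good \<A> (\<L> \<A>)"
    by metis
  show thesis
  proof (rule that[of "\<Union>\<A>\<in>\<C>. \<L> \<A>"])
    show "openin X L" "compactin X (X closure_of L)" if "L \<in> (\<Union>\<A>\<in>\<C>. \<L> \<A>)" for L
      using that \<L> by (auto simp: good_def)
    have "\<Union>(\<Union>\<A>\<in>\<C>. \<L> \<A>) = (\<Union>\<A>\<in>\<C>. \<Union>(\<L> \<A>))"
      by blast
    also have "\<dots> = (\<Union>\<A>\<in>\<C>. \<Union>\<A>)"
      using \<L> by (intro SUP_cong) (auto simp: good_def)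
    also have "\<dots> = topspace X"
      using \<C>(1) \<J>(3) by blast
    finally show "\<Union>(\<Union>\<A>\<in>\<C>. \<L> \<A>) = topspace X" .
    fix L assume "L \<in> (\<Union>\<A>\<in>\<C>. \<L> \<A>)"
    then obtain \<A> where \<A>: "\<A> \<in> \<C>" "L \<in> \<L> \<A>"
      by blast
    have LA: "L' \<subseteq> \<Union>\<B>" if "\<B> \<in> \<C>" "L' \<in> \<L> \<B>" for L' \<B>
      using \<L>[OF that(1)] that(2) unfolding good_def by blast
    have "{L' \<in> (\<Union>\<A>\<in>\<C>. \<L> \<A>). L' \<inter> L \<noteq> {}} \<subseteq> {L' \<in> \<L> \<A>. L' \<inter> L \<noteq> {}}"
    proof
      fix L' assume "L' \<in> {L' \<in> (\<Union>\<A>\<in>\<C>. \<L> \<A>). L' \<inter> L \<noteq> {}}"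
      then obtain \<B> where \<B>: "\<B> \<in> \<C>" "L' \<in> \<L> \<B>" "L' \<inter> L \<noteq> {}"
        by blast
      then have "\<Union>\<B> \<inter> \<Union>\<A> \<noteq> {}"
        using LA[OF \<A>] LA[OF \<B>(1,2)] by blast
      then have "\<B> = \<A>"
        using \<C>(3) \<A>(1) \<B>(1) by blast
      then show "L' \<in> {L' \<in> \<L> \<A>. L' \<inter> L \<noteq> {}}"
        using \<B> by blast
    qed
    moreover have "countable {L' \<in> \<L> \<A>. L' \<inter> L \<noteq> {}}"
      using \<L>[OF \<A>(1)] \<A>(2) by (simp add: good_def)
    ultimately show "countable {L' \<in> (\<Union>\<A>\<in>\<C>. \<L> \<A>). L' \<inter> L \<noteq> {}}"
      using countable_subset by blast
  qed
qed

text \<open>Chain components once more, now countable. Each has a clopen union, which contains the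
  compact closures of its members and is therefore sigma-compact, hence Lindelof.\<close>

lemma paracompact: "paracompact_space X"
proof (rule star_countable_open_cover)
  fix \<L>
  assume \<L>: "\<And>L. L \<in> \<L> \<Longrightarrow> openin X L" "\<And>L. L \<in> \<L> \<Longrightarrow> compactin X (X closure_of L)"
    "\<Union>\<L> = topspace X" "\<And>L. L \<in> \<L> \<Longrightarrow> countable {L' \<in> \<L>. L' \<inter> L \<noteq> {}}"
  have star: "{L' \<in> \<L>. L' \<inter> L \<noteq> {}} \<lesssim> (UNIV :: nat set)" if "L \<in> \<L>" for L
    using \<L>(4)[OF that] by (simp add: countable_iff_lepoll_nat)
  obtain \<C> where \<C>: "\<Union>\<C> = \<L>" "\<And>\<A>. \<A> \<in> \<C> \<Longrightarrow> \<A> \<lesssim> (UNIV :: nat set)"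
    "\<And>\<A> \<B>. \<A> \<in> \<C> \<Longrightarrow> \<B> \<in> \<C> \<Longrightarrow> \<A> \<noteq> \<B> \<Longrightarrow> \<Union>\<A> \<inter> \<Union>\<B> = {}"
    using star_small_components[OF infinite_UNIV_nat star] by metis
  show ?thesis
  proof (rule paracompact_space_disjoint_Lindelof[OF regular])
    show "disjoint (Union ` \<C>)"
      using \<C>(3) by (auto simp: pairwise_def disjnt_def)
    show "\<Union>(Union ` \<C>) = topspace X"
      using \<C>(1) \<L>(3) by blast
    fix Q assume "Q \<in> Union ` \<C>"
    then obtain \<A> where \<A>: "\<A> \<in> \<C>" "Q = \<Union>\<A>"
      by blast
    have \<A>\<L>: "L \<in> \<L>" if "L \<in> \<A>" for L
      using that \<A>(1) \<C>(1) by blast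
    show "openin X Q"
      unfolding \<A>(2) using \<L>(1) \<A>\<L> by blast
    have "closedin X (\<Union>\<A>)"
      using \<L>(1,3) \<C>(1,3) \<A>(1) by (intro component_closedin[of \<C>]) auto
    then have "X closure_of L \<subseteq> \<Union>\<A>" if "L \<in> \<A>" for L
      using that by (intro closure_of_minimal) auto
    moreover have "L \<subseteq> X closure_of L" if "L \<in> \<A>" for L
      using \<L>(1)[OF \<A>\<L>[OF that]] by (simp add: closure_of_subset openin_subset)
    ultimately have "Q = \<Union>((closure_of) X ` \<A>)"
      unfolding \<A>(2) by blast
    moreover have "Lindelof_space (subtopology X (\<Union>((closure_of) X ` \<A>)))"
    proof (rule Lindelof_space_Union)
      show "countable ((closure_of) X ` \<A>)"
        using \<C>(2)[OF \<A>(1)] by (simp add: countable_iff_lepoll_nat[symmetric])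
      show "Lindelof_space (subtopology X K)" if "K \<in> (closure_of) X ` \<A>" for K
        using that \<L>(2) \<A>\<L> by (auto intro!: compact_imp_Lindelof_space compact_space_subtopology)
    qed
    ultimately show "Lindelof_space (subtopology X Q)"
      by simp
  qed
qed

end

theorem theorem2p8:
  assumes locally_countable_sigma_discrete:
    "\<forall>(K :: 'a topology) Y.
       compact_space K \<and> Hausdorff_space K \<and> countably_tight K \<and>
       Y \<subseteq> topspace K \<and> locally_countable_space (subtopology K Y) \<and> has_card_aleph1 Y
       \<longrightarrow> sigma_discrete_subspace K Y"
    and normal_first_countable_cwH:
    "\<forall>Z :: 'a topology.
       Hausdorff_space Z \<and> normal_space Z \<and> first_countable Z
       \<longrightarrow> collectionwise_Hausdorff Z"
  shows
    "\<forall>X :: 'a topology.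
       Hausdorff_space X \<and> locally_compact_space X \<and> perfectly_normal_space X
       \<longrightarrow> paracompact_space X"
proof (intro allI impI)
  fix X :: "'a topology"
  assume X: "Hausdorff_space X \<and> locally_compact_space X \<and> perfectly_normal_space X"
  interpret locally_compact_perfectly_normal X
    using X by unfold_locales auto
  interpret locally_countable_sigma_closed_discrete X
  proof
    show "collectionwise_Hausdorff X"
      using normal_first_countable_cwH Hausdorff normal first_countable by blast
    fix Y
    assume Y: "Y \<subseteq> topspace X" "\<And>y. y \<in> Y \<Longrightarrow> \<exists>U. openin X U \<and> y \<in> U \<and> countable (U \<inter> Y)"
      "Y \<lesssim> (UNIV :: omega1 set)"
    show "\<exists>F :: nat \<Rightarrow> 'a set. (\<forall>n. closed_discrete X (F n)) \<and> (\<Union>n. F n) = Y"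
    proof (rule locally_countable_eq_UN_closed_discrete[OF _ Y])
      show "sigma_discrete_subspace K Z"
        if "compact_space K" "Hausdorff_space K" "countably_tight K" "Z \<subseteq> topspace K"
          "locally_countable_space (subtopology K Z)" "has_card_aleph1 Z"
        for K :: "'a topology" and Z
        using that locally_countable_sigma_discrete by blast
      fix F :: "nat \<Rightarrow> 'a set"
      assume "\<And>n. closed_discrete X (F n)" "(\<Union>n. F n) = Y"
      then show ?thesis
        by blast
    qed
  qed
  show "paracompact_space X"
    by (rule paracompact)
qed

end
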